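(* Consider the $M/GI/1/n$ queueing system with marking probability $p$ and loss probability $\Pi_n$ described in the context. If $\varrho=1$ and $\varrho_2<\infty$, then as $n\to\infty$ $$\Pi_{n+1}-\Pi_n=\frac{\dfrac{1}{n(n+1)}\cdot\dfrac{2}{\varrho_2}\,(p-1)}{\Big(\dfrac{2}{\varrho_2}+\dfrac1{n+1}\Big)\Big(\dfrac{2}{\varrho_2}+\dfrac1n\Big)}+o\Big(\frac1{n^2}\Big).$$
   Context: $M/GI/1/n$ system: messages arrive according to a Poisson process of rate $\lambda>0$ at a single server with $n$ waiting places (not counting the place in service); service times are i.i.d., independent of arrivals, with distribution function $B(x)$ and mean $b=\int_0^\infty x\,dB(x)\in(0,\infty)$. A message that finds at most $n$ messages in the system on arrival is accepted, otherwise it is refused (leaves without service). The arrival rate, service distribution and $p$ are the same for all $n$. Let $\varrho_j=\lambda^j\int_0^\infty x^j\,dB(x)$ and $\varrho=\varrho_1=\lambda b$. Each message is, independently of everything else, marked (erroneous) with probability $p$; a marked message still occupies the buffer and is served if it is not refused. A message is lost if it is refused or marked. (This is the case in which every message contains the same number $l$ of packets and the buffer holds $N$ packets, with $n=\lfloor N/l\rfloor$.) A busy period starts when a message arrives to the empty system and ends when the system next becomes empty. $P_n$ and $R_n$ are, respectively, the number of processed (served) messages and the number of refused messages during a busy period of the $M/GI/1/n$ system. The loss probability is $$\Pi_n=\frac{\mathbf E R_n+p\,\mathbf E P_n}{\mathbf E R_n+\mathbf E P_n}.$$ *)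

theory Defs
  imports "HOL-Probability.Probability" "HOL-Library.Landau_Symbols"
begin

text \<open>
  Sample-path dynamics of the single-server first-in-first-out system with \<open>n\<close> waiting places.
  Messages are numbered \<open>0, 1, 2, \<dots>\<close> in order of arrival, \<open>a k\<close> being the arrival time of
  message \<open>k\<close>; the system is empty before \<open>a 0\<close>. The value \<open>departure n a s k\<close> is \<open>Some d\<close> if
  message \<open>k\<close> is accepted and leaves after service at time \<open>d\<close>, and \<open>None\<close> if it is refused.
  The message is accepted iff at most \<open>n\<close> of the previously accepted ones are still present at
  time \<open>a k\<close>. Its service then starts at \<open>a k\<close> or at the last of the earlier departures,
  whichever is later. Refused messages are not served, so service times are numbered in order
  of service: \<open>s m\<close> is the service time of the accepted message preceded by exactly \<open>m\<close>
  accepted ones.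
\<close>

context
  notes conj_cong [fundef_cong]
begin

function departure ::
  "nat \<Rightarrow> (nat \<Rightarrow> real) \<Rightarrow> (nat \<Rightarrow> real) \<Rightarrow> nat \<Rightarrow> real option" where
  "departure n a s k =
    (if card {i. i < k \<and> (\<exists>d. departure n a s i = Some d \<and> a k < d)} \<le> n
     then Some (Max (insert (a k) {d. \<exists>i. i < k \<and> departure n a s i = Some d})
                + s (card {i. i < k \<and> departure n a s i \<noteq> None}))
     else None)"
  by pat_completeness auto
termination
  by (relation "Wellfounded.measure (\<lambda>(n, a, s, k). k)") auto

end

declare departure.simps [simp del]

definition accepted :: "nat \<Rightarrow> (nat \<Rightarrow> real) \<Rightarrow> (nat \<Rightarrow> real) \<Rightarrow> nat \<Rightarrow> bool" where
  "accepted n a s k \<longleftrightarrow> departure n a s k \<noteq> None"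

definition in_system :: "nat \<Rightarrow> (nat \<Rightarrow> real) \<Rightarrow> (nat \<Rightarrow> real) \<Rightarrow> real \<Rightarrow> nat set" where
  "in_system n a s t = {i. a i \<le> t \<and> (\<exists>d. departure n a s i = Some d \<and> t < d)}"

text \<open>
  The messages arriving during the busy period that message \<open>0\<close> starts: those before whose
  arrival the system has not become empty again. Message \<open>0\<close> itself always belongs to it, even
  if its service time is \<open>0\<close>.
\<close>

definition busy_period :: "nat \<Rightarrow> (nat \<Rightarrow> real) \<Rightarrow> (nat \<Rightarrow> real) \<Rightarrow> nat set" where
  "busy_period n a s = {k. \<forall>t. a 0 \<le> t \<and> t < a k \<longrightarrow> in_system n a s t \<noteq> {}}"

definition num_processed :: "nat \<Rightarrow> (nat \<Rightarrow> real) \<Rightarrow> (nat \<Rightarrow> real) \<Rightarrow> nat" where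
  "num_processed n a s = card {k \<in> busy_period n a s. accepted n a s k}"

definition num_refused :: "nat \<Rightarrow> (nat \<Rightarrow> real) \<Rightarrow> (nat \<Rightarrow> real) \<Rightarrow> nat" where
  "num_refused n a s = card {k \<in> busy_period n a s. \<not> accepted n a s k}"

text \<open>
  The random input. The Poisson arrival process of rate \<open>lam\<close> is given by its interarrival
  times \<open>T\<close> (\<open>T 0\<close> being the time until the first arrival), and \<open>B\<close> is the law of the service
  times \<open>S\<close>, so that \<open>cdf B\<close> is their distribution function. Independence of the combined
  family says that all interarrival and service times are mutually independent.
\<close>

locale MGI1_input = prob_space M
  for M :: "'w measure" +
  fixes lam :: real
    and B :: "real measure"
    and T S :: "nat \<Rightarrow> 'w \<Rightarrow> real"
  assumes lam_pos: "lam > 0"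
    and B_law: "real_distribution B"
    and B_nonneg: "AE x in B. 0 \<le> x"
    and B_integrable: "integrable B (\<lambda>x. x)"
    and B_mean_pos: "(\<integral>x. x \<partial>B) > 0"
    and interarrival: "\<And>k. distributed M lborel (T k) (exponential_density lam)"
    and service: "\<And>k. distr M borel (S k) = B"
    and independent: "indep_vars (\<lambda>_. borel) (case_sum T S) UNIV"

definition arrival_time :: "(nat \<Rightarrow> 'w \<Rightarrow> real) \<Rightarrow> 'w \<Rightarrow> nat \<Rightarrow> real" where
  "arrival_time T \<omega> k = (\<Sum>i\<le>k. T i \<omega>)"

text \<open>
  With a finite buffer the busy period is almost surely finite and both counts have finite
  mean, so the default values of \<open>card\<close> and of the Bochner integral play no role below.
\<close>

definition EP :: "'w measure \<Rightarrow> (nat \<Rightarrow> 'w \<Rightarrow> real) \<Rightarrow> (nat \<Rightarrow> 'w \<Rightarrow> real) \<Rightarrow> nat \<Rightarrow> real" where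
  "EP M T S n = (\<integral>\<omega>. real (num_processed n (arrival_time T \<omega>) (\<lambda>m. S m \<omega>)) \<partial>M)"

definition ER :: "'w measure \<Rightarrow> (nat \<Rightarrow> 'w \<Rightarrow> real) \<Rightarrow> (nat \<Rightarrow> 'w \<Rightarrow> real) \<Rightarrow> nat \<Rightarrow> real" where
  "ER M T S n = (\<integral>\<omega>. real (num_refused n (arrival_time T \<omega>) (\<lambda>m. S m \<omega>)) \<partial>M)"

text \<open>
  Marked messages occupy the buffer and are served like the others, so the marks affect neither
  count and enter the loss probability only through the marking probability \<open>p\<close>.
\<close>

definition loss_prob ::
  "'w measure \<Rightarrow> (nat \<Rightarrow> 'w \<Rightarrow> real) \<Rightarrow> (nat \<Rightarrow> 'w \<Rightarrow> real) \<Rightarrow> real \<Rightarrow> nat \<Rightarrow> real" where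
  "loss_prob M T S p n =
    (ER M T S n + p * EP M T S n) / (ER M T S n + EP M T S n)"

definition rho :: "real \<Rightarrow> real measure \<Rightarrow> nat \<Rightarrow> real" where
  "rho lam B j = lam ^ j * (\<integral>x. x ^ j \<partial>B)"

end

theory Submission
  imports Defs "HOL-Real_Asymp.Real_Asymp"
begin

text \<open>
  Let \<open>u n\<close> be the mean number of messages served in a busy period. During a busy period the
  server works without pause, and the exponential interarrival times have no memory, so the
  numbers of arrivals during the successive services are independent with one common mixed
  Poisson law \<open>\<xi>\<close>. Queue lengths at the ends of services therefore form a Markov chain on the
  finite set \<open>{0..n}\<close>, with steps \<open>i \<mapsto> min (i - 1 + \<xi>) n\<close>, and a mean of costs accumulated until this
  chain hits \<open>0\<close> is the unique solution of a finite linear system.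

  For refusals the system is solved by the identity function: a service removes one message, and
  at load \<open>1\<close> it brings one on average, either accepted or refused. Hence exactly one message is
  refused in the mean, for every \<open>n \<ge> 1\<close>. For services the solution is
  \<open>i \<mapsto> u n + u (n - 1) + \<dots> + u (n - i + 1)\<close>: removing the last of \<open>i\<close> messages and all
  that come in meanwhile takes a busy period of a system with \<open>n - i + 1\<close> waiting places. The
  equations then amount to
  \<open>u n = 1 + (\<Sum>j<n. P (\<xi> > j) * u (n - j))\<close>. The weights \<open>P (\<xi> > j)\<close> add up to the mean \<open>1\<close> of \<open>\<xi>\<close>,
  so that this is a renewal equation, and \<open>u (n + 1) - u n\<close> is a multiple of a renewal
  sequence. By the renewal theorem it tends to \<open>1 / E (\<xi> (\<xi> - 1) / 2) = 2 / \<rho>\<^sub>2\<close>. Consequently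
  \<open>u n / n\<close> has the same limit.

  The loss probability is \<open>(1 + p * u n) / (1 + u n)\<close>. Its increment is
  \<open>(p - 1) * (u (n + 1) - u n) / ((1 + u n) * (1 + u (n + 1)))\<close>, and \<open>n\<^sup>2\<close> times this tends to
  \<open>(p - 1) * \<rho>\<^sub>2 / 2\<close>, which is also the limit of \<open>n\<^sup>2\<close> times the claimed main term.

  Three lemmas carry the passage from the sample paths to the chain: \<open>poisson_regeneration\<close> (the
  memoryless property for a whole stream of gaps), \<open>SUP_cost_path\<close> (a pathwise identity valid
  outside a null set) and \<open>busy_period_iff\<close>, from which the counts are measurable on the whole
  space. The last point matters because the underlying space need not be complete: the Bochner
  integral of a function that agrees with a measurable one almost everywhere without being
  measurable itself has the default value \<open>0\<close>.
\<close>

section \<open>A renewal theorem\<close>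

text \<open>
  Tannery's theorem for convolutions. The index runs along \<open>\<phi>\<close> so that the lemma applies to
  subsequences as well as to full sequences.
\<close>

lemma convolution_tendsto:
  fixes w y :: "nat \<Rightarrow> real" and \<phi> :: "nat \<Rightarrow> nat"
  assumes w: "summable (\<lambda>k. \<bar>w k\<bar>)" and y: "\<And>n. \<bar>y n\<bar> \<le> K"
    and \<phi>: "filterlim \<phi> at_top sequentially"
    and lim: "\<And>k. (\<lambda>j. y (\<phi> j - k)) \<longlonglongrightarrow> l"
  shows "(\<lambda>j. \<Sum>k\<le>\<phi> j. w k * y (\<phi> j - k)) \<longlonglongrightarrow> l * suminf w"
proof -
  define a where "a k j = (if k \<le> \<phi> j then w k * y (\<phi> j - k) else 0)" for k j
  have K: "0 \<le> K" using y[of 0] by linarith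
  have "(\<lambda>j. \<Sum>k. a k j) \<longlonglongrightarrow> (\<Sum>k. w k * l)"
  proof (rule tannerys_theorem[THEN conjunct2, THEN conjunct2])
    fix k
    have "\<forall>\<^sub>F j in sequentially. k \<le> \<phi> j"
      using \<phi> by (simp add: filterlim_at_top)
    then have "\<forall>\<^sub>F j in sequentially. a k j = w k * y (\<phi> j - k)"
      by eventually_elim (simp add: a_def)
    then show "a k \<longlonglongrightarrow> w k * l"
      using tendsto_mult[OF tendsto_const lim[of k], of "w k"] by (simp add: filterlim_cong)
  next
    have "norm (a k n) \<le> \<bar>w k\<bar> * K" for k n
      using K y[of "\<phi> n - k"] by (auto simp: a_def abs_mult intro!: mult_left_mono)
    then show "\<forall>\<^sub>F (k, n) in at_top \<times>\<^sub>F sequentially. norm (a k n) \<le> \<bar>w k\<bar> * K"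
      by (intro always_eventually) auto
  next
    show "summable (\<lambda>k. \<bar>w k\<bar> * K)"
      using w by (rule summable_mult2)
  qed simp
  moreover have "(\<Sum>k. a k j) = (\<Sum>k\<le>\<phi> j. w k * y (\<phi> j - k))" for j
    by (subst suminf_finite[of "{..\<phi> j}"]) (auto simp: a_def)
  moreover have "(\<Sum>k. w k * l) = l * suminf w"
    using suminf_mult[of w l] w by (simp add: summable_rabs_cancel mult.commute)
  ultimately show ?thesis by simp
qed

text \<open>
  The law \<open>p\<close> of the distances between renewals is shifted by one: \<open>p k\<close> is the probability of the
  distance \<open>k + 1\<close>. Then \<open>F k\<close> is the probability that the distance exceeds \<open>k\<close>, and \<open>suminf F\<close>
  is the mean distance. The condition \<open>0 < p 0\<close> is a strong form of aperiodicity.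
\<close>

locale renewal =
  fixes p :: "nat \<Rightarrow> real" and F x :: "nat \<Rightarrow> real"
  assumes p_nonneg: "\<And>k. 0 \<le> p k" and p_sums: "p sums 1" and p0: "0 < p 0"
    and F_0: "F 0 = 1" and F_Suc: "\<And>k. F (Suc k) = F k - p k"
    and F_nonneg: "\<And>k. 0 \<le> F k" and F_summable: "summable F"
    and x_Suc: "\<And>n. x (Suc n) = (\<Sum>k\<le>n. p k * x (n - k))"
begin

text \<open>
  The lower limit of a solution is minus the upper limit of its negative, so that only upper limits
  have to be computed.
\<close>

lemma renewal_uminus: "renewal p F (\<lambda>n. - x n)"
  by unfold_locales
    (use p_nonneg p_sums p0 F_0 F_Suc F_nonneg F_summable in \<open>simp_all add: x_Suc sum_negf\<close>)

lemma bounded_by_initial: "\<bar>x n\<bar> \<le> \<bar>x 0\<bar>"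
proof (induction n rule: less_induct)
  case (less n)
  show ?case
  proof (cases n)
    case (Suc m)
    have "\<bar>x n\<bar> \<le> (\<Sum>k\<le>m. \<bar>p k * x (m - k)\<bar>)"
      unfolding Suc x_Suc by (rule sum_abs)
    also have "\<dots> \<le> (\<Sum>k\<le>m. p k * \<bar>x 0\<bar>)"
      using less Suc p_nonneg by (intro sum_mono) (auto simp: abs_mult intro!: mult_left_mono)
    also have "\<dots> = (\<Sum>k\<le>m. p k) * \<bar>x 0\<bar>"
      by (simp add: sum_distrib_right)
    also have "\<dots> \<le> 1 * \<bar>x 0\<bar>"
      using sum_le_suminf[of p "{..m}"] p_sums p_nonneg
      by (intro mult_right_mono) (auto simp: sums_iff)
    finally show ?thesis by simp
  qed simp
qed

text \<open>
  The sum over \<open>k\<close> runs over the possible last renewals \<open>n - k\<close> up to time \<open>n\<close>; it does not change from one time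
  to the next because \<open>F (Suc k) = F k - p k\<close>.
\<close>

lemma tail_convolution: "(\<Sum>k\<le>n. F k * x (n - k)) = x 0"
proof (induction n)
  case (Suc n)
  have "(\<Sum>k\<le>Suc n. F k * x (Suc n - k)) = x (Suc n) + (\<Sum>k\<le>n. F (Suc k) * x (n - k))"
    by (subst sum.atMost_Suc_shift) (simp add: F_0)
  also have "(\<Sum>k\<le>n. F (Suc k) * x (n - k)) = (\<Sum>k\<le>n. F k * x (n - k)) - x (Suc n)"
    by (simp add: F_Suc x_Suc left_diff_distrib flip: sum_subtractf)
  finally show ?case using Suc by simp
qed (simp add: F_0)

text \<open>
  The argument of Erdos, Feller and Pollard. Along a subsequence \<open>\<phi>\<close> on which \<open>x\<close> approaches its upper
  limit \<open>L\<close>, the value \<open>x (\<phi> j)\<close> is an average of earlier values, none of which exceeds \<open>L\<close> much.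
  As \<open>p 0 > 0\<close>, the value just before must approach \<open>L\<close> too, and by induction so must those at
  each fixed distance. The identity \<open>tail_convolution\<close> then reads \<open>x 0 = L * suminf F\<close> in the limit.
  A majorant converging to \<open>L\<close> stands for the upper limit itself.
\<close>

lemma limsup_value:
  obtains Y where "\<And>n. x n \<le> Y n" and "Y \<longlonglongrightarrow> x 0 / suminf F"
proof -
  define Y where "Y n = (SUP m\<in>{n..}. x m)" for n
  have bdd: "bdd_above (x ` A)" for A
    by (rule bdd_aboveI2[where M = "\<bar>x 0\<bar>"]) (use bounded_by_initial abs_le_D1 in blast)
  have le_Y: "x m \<le> Y n" if "n \<le> m" for m n
    unfolding Y_def using that by (intro cSUP_upper bdd) simp
  have Y_le: "Y n \<le> \<bar>x 0\<bar>" for n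
    unfolding Y_def by (intro cSUP_least) (use bounded_by_initial abs_le_D1 in auto)
  have Y_bounded: "\<bar>Y n\<bar> \<le> \<bar>x 0\<bar>" for n
    using Y_le[of n] le_Y[of n n] bounded_by_initial[of n] by linarith
  have "decseq Y"
    unfolding decseq_def Y_def by (auto intro!: cSUP_subset_mono bdd)
  moreover have "bdd_below (range Y)"
    using Y_bounded by (intro bdd_belowI2[where m = "- \<bar>x 0\<bar>"]) (metis abs_le_D2 minus_le_iff)
  ultimately have "Y \<longlonglongrightarrow> Inf (range Y)"
    by (rule LIMSEQ_decseq_INF[rotated])
  then obtain L where Y_lim: "Y \<longlonglongrightarrow> L" by blast
  (* A subsequence along which x approaches its upper limit L. *)
  have "\<exists>m\<ge>j. Y j - 1 / (real j + 1) < x m" for j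
  proof -
    have "Y j - 1 / (real j + 1) < (SUP m\<in>{j..}. x m)"
      by (simp add: Y_def)
    then show ?thesis
      by (subst (asm) less_cSUP_iff) (auto intro: bdd)
  qed
  then obtain \<phi> where \<phi>_ge: "\<And>j. j \<le> \<phi> j"
    and \<phi>_close: "\<And>j. Y j - 1 / (real j + 1) < x (\<phi> j)"
    by metis
  have \<phi>_top: "filterlim \<phi> at_top sequentially"
    using \<phi>_ge by (intro filterlim_at_top_mono[OF filterlim_ident]) simp
  have shift_top: "filterlim (\<lambda>j. \<phi> j - k) at_top sequentially" for k
    by (rule filterlim_compose[OF filterlim_minus_const_nat_at_top \<phi>_top])
  have Y_shift: "(\<lambda>j. Y (\<phi> j - k)) \<longlonglongrightarrow> L" for k
    by (rule filterlim_compose[OF Y_lim shift_top])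
  have x_\<phi>: "(\<lambda>j. x (\<phi> j - k)) \<longlonglongrightarrow> L" for k
  proof (induction k)
    case 0
    have "(\<lambda>j. Y j - 1 / (real j + 1)) \<longlonglongrightarrow> L - 0"
      by (intro tendsto_diff Y_lim) real_asymp
    moreover have "\<forall>\<^sub>F j in sequentially. Y j - 1 / (real j + 1) \<le> x (\<phi> j)"
      using \<phi>_close by (intro always_eventually) (auto intro: less_imp_le)
    moreover have "\<forall>\<^sub>F j in sequentially. x (\<phi> j) \<le> Y j"
      using le_Y \<phi>_ge by simp
    ultimately show ?case
      using Y_lim by (auto intro: tendsto_sandwich)
  next
    case (Suc k)
    let ?n = "\<lambda>j. \<phi> j - Suc k"
    (* The renewal equation for x (\<phi> j - k), solved for the term with p 0; the other terms are
       bounded by the majorant Y. *)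
    let ?lower = "\<lambda>j. (x (\<phi> j - k) - (\<Sum>i\<le>?n j. p i * Y (?n j - i)) + p 0 * Y (?n j)) / p 0"
    have p_abs: "summable (\<lambda>k. \<bar>p k\<bar>)"
      using p_sums p_nonneg by (simp add: sums_iff)
    have "(\<lambda>j. \<Sum>i\<le>?n j. p i * Y (?n j - i)) \<longlonglongrightarrow> L * suminf p"
      by (intro convolution_tendsto[OF p_abs Y_bounded shift_top]) (use Y_shift in simp)
    then have "?lower \<longlonglongrightarrow> (L - L * suminf p + p 0 * L) / p 0"
      using p0 by (intro tendsto_intros Suc Y_shift) auto
    then have "?lower \<longlonglongrightarrow> L"
      using p0 p_sums by (simp add: sums_iff)
    moreover have "\<forall>\<^sub>F j in sequentially. ?lower j \<le> x (?n j)"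
    proof -
      have "\<forall>\<^sub>F j in sequentially. Suc k \<le> \<phi> j"
        using \<phi>_top by (simp add: filterlim_at_top)
      then show ?thesis
      proof eventually_elim
        case (elim j)
        then have "x (\<phi> j - k) = (\<Sum>i\<le>?n j. p i * x (?n j - i))"
          using x_Suc[of "?n j"] by (simp add: Suc_diff_Suc)
        also have "\<dots> - p 0 * x (?n j) = (\<Sum>i\<in>{..?n j} - {0}. p i * x (?n j - i))"
          by (subst sum.remove[of _ 0]) auto
        also have "\<dots> \<le> (\<Sum>i\<in>{..?n j} - {0}. p i * Y (?n j - i))"
          using p_nonneg le_Y by (intro sum_mono mult_left_mono) auto
        also have "\<dots> = (\<Sum>i\<le>?n j. p i * Y (?n j - i)) - p 0 * Y (?n j)"
          by (subst (2) sum.remove[of _ 0]) auto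
        finally show ?case
          using p0 by (simp add: field_simps)
      qed
    qed
    moreover have "\<forall>\<^sub>F j in sequentially. x (?n j) \<le> Y (?n j)"
      using le_Y by simp
    ultimately show ?case
      by (rule tendsto_sandwich[OF _ _ _ Y_shift, rotated 2])
  qed
  have "(\<lambda>j. \<Sum>k\<le>\<phi> j. F k * x (\<phi> j - k)) \<longlonglongrightarrow> L * suminf F"
    using F_summable F_nonneg bounded_by_initial \<phi>_top x_\<phi> by (intro convolution_tendsto) auto
  then have "x 0 = L * suminf F"
    by (simp add: tail_convolution LIMSEQ_const_iff)
  moreover have "0 < suminf F"
    using F_0 F_nonneg F_summable by (intro suminf_pos2[of F 0]) auto
  ultimately have "L = x 0 / suminf F"
    by simp
  then show ?thesis
    using that[of Y] le_Y Y_lim by auto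
qed

theorem renewal_theorem: "x \<longlonglongrightarrow> x 0 / suminf F"
proof -
  interpret minus: renewal p F "\<lambda>n. - x n" by (rule renewal_uminus)
  obtain Y where Y: "\<And>n. x n \<le> Y n" "Y \<longlonglongrightarrow> x 0 / suminf F"
    using limsup_value by blast
  obtain Z where Z: "\<And>n. - x n \<le> Z n" "Z \<longlonglongrightarrow> - x 0 / suminf F"
    using minus.limsup_value by blast
  have "- Z n \<le> x n" for n
    using Z(1)[of n] by simp
  moreover have "(\<lambda>n. - Z n) \<longlonglongrightarrow> x 0 / suminf F"
    using tendsto_minus[OF Z(2)] by simp
  ultimately show ?thesis
    using Y by (intro tendsto_sandwich[of "\<lambda>n. - Z n" x sequentially Y]) auto
qed

end

fun renewal_seq :: "(nat \<Rightarrow> real) \<Rightarrow> real \<Rightarrow> nat \<Rightarrow> real" where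
  "renewal_seq p x0 0 = x0"
| "renewal_seq p x0 (Suc n) = (\<Sum>k\<le>n. p k * renewal_seq p x0 (n - k))"

text \<open>
  Summation turns the renewal equation into one with constant inhomogeneity, the form in which it
  arises from first step analysis.
\<close>

lemma sum_renewal_seq:
  fixes p x0
  defines "U \<equiv> \<lambda>m. \<Sum>j<m. renewal_seq p x0 j"
  shows "U (Suc m) = x0 + (\<Sum>k<m. p k * U (m - k))"
proof (induction m)
  case (Suc m)
  have "U (Suc (Suc m)) = U (Suc m) + (\<Sum>k\<le>m. p k * renewal_seq p x0 (m - k))"
    by (simp add: U_def)
  also have "(\<Sum>k\<le>m. p k * renewal_seq p x0 (m - k)) = (\<Sum>k\<le>m. p k * U (Suc m - k) - p k * U (m - k))"
    by (rule sum.cong) (simp_all add: U_def Suc_diff_le algebra_simps)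
  also have "\<dots> = (\<Sum>k<Suc m. p k * U (Suc m - k)) - (\<Sum>k<m. p k * U (m - k))"
    by (simp add: sum_subtractf lessThan_Suc_atMost[symmetric]) (simp add: U_def)
  finally show ?case using Suc by simp
qed (simp add: U_def)

lemma cesaro_tendsto:
  fixes x :: "nat \<Rightarrow> real"
  assumes x: "x \<longlonglongrightarrow> c"
  shows "(\<lambda>n. (\<Sum>k<n. x k) / real n) \<longlonglongrightarrow> c"
proof -
  have "(\<lambda>n. (\<Sum>k<n. x k - c) / real n) \<longlonglongrightarrow> 0"
  proof (rule LIMSEQ_I)
    fix e :: real assume e: "0 < e"
    have "\<forall>\<^sub>F n in sequentially. \<bar>x n - c\<bar> < e / 2"
      using tendstoD[OF x, of "e / 2"] e by (simp add: dist_real_def)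
    then obtain N where N: "\<And>n. N \<le> n \<Longrightarrow> \<bar>x n - c\<bar> < e / 2"
      by (auto simp: eventually_sequentially)
    define A where "A = (\<Sum>k<N. \<bar>x k - c\<bar>)"
    have "\<forall>\<^sub>F n in sequentially. \<bar>A / real n\<bar> < e / 2"
      using tendstoD[OF lim_const_over_n[of A], of "e / 2"] e by (simp add: dist_real_def)
    then obtain N' where N': "\<And>n. N' \<le> n \<Longrightarrow> \<bar>A / real n\<bar> < e / 2"
      by (auto simp: eventually_sequentially)
    show "\<exists>no. \<forall>n\<ge>no. norm ((\<Sum>k<n. x k - c) / real n - 0) < e"
    proof (intro exI allI impI)
      fix n assume n: "max (max N N') 1 \<le> n"
      have "\<bar>\<Sum>k<n. x k - c\<bar> \<le> (\<Sum>k<n. \<bar>x k - c\<bar>)"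
        by (rule sum_abs)
      also have "\<dots> = A + (\<Sum>k\<in>{N..<n}. \<bar>x k - c\<bar>)"
        unfolding A_def lessThan_atLeast0 using n by (subst sum.atLeastLessThan_concat) auto
      also have "(\<Sum>k\<in>{N..<n}. \<bar>x k - c\<bar>) \<le> (\<Sum>k\<in>{N..<n}. e / 2)"
        using N by (intro sum_mono) (auto intro: less_imp_le)
      also have "\<dots> \<le> real n * (e / 2)"
        using e n by (simp add: mult_right_mono)
      finally have "\<bar>\<Sum>k<n. x k - c\<bar> / real n \<le> A / real n + e / 2"
        using n by (simp add: field_simps)
      moreover have "A / real n < e / 2"
        by (rule le_less_trans[OF abs_ge_self N']) (use n in simp)
      ultimately have "\<bar>\<Sum>k<n. x k - c\<bar> / real n < e"
        by linarith
      then show "norm ((\<Sum>k<n. x k - c) / real n - 0) < e"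
        by simp
    qed
  qed
  then have "(\<lambda>n. (\<Sum>k<n. x k - c) / real n + c) \<longlonglongrightarrow> 0 + c"
    by (intro tendsto_add) simp_all
  moreover have "\<forall>\<^sub>F n in sequentially. (\<Sum>k<n. x k - c) / real n + c = (\<Sum>k<n. x k) / real n"
    using eventually_gt_at_top[of 0] by eventually_elim (simp add: sum_subtractf field_simps)
  ultimately show ?thesis
    by (simp add: filterlim_cong)
qed


section \<open>Counting exponential gaps\<close>

text \<open>
  A stream \<open>\<tau>\<close> holds the gaps between consecutive arrivals, the first counted from now. The
  predicate says that exactly \<open>k\<close> arrivals occur strictly before time \<open>x\<close>. An arrival at \<open>x\<close> itself
  is left to the next service, in accordance with the convention that a message departing at that
  moment has gone.
\<close>

primrec count_is :: "nat \<Rightarrow> real \<Rightarrow> real stream \<Rightarrow> bool" where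
  "count_is 0 x \<tau> \<longleftrightarrow> x \<le> shd \<tau>"
| "count_is (Suc k) x \<tau> \<longleftrightarrow> shd \<tau> < x \<and> count_is k (x - shd \<tau>) (stl \<tau>)"

text \<open>
  The gaps as seen at time \<open>x\<close>, given that \<open>k\<close> arrivals have occurred before.
\<close>

primrec residual :: "nat \<Rightarrow> real \<Rightarrow> real stream \<Rightarrow> real stream" where
  "residual 0 x \<tau> = (shd \<tau> - x) ## stl \<tau>"
| "residual (Suc k) x \<tau> = residual k (x - shd \<tau>) (stl \<tau>)"

lemma count_is_unique: "count_is j x \<tau> \<Longrightarrow> count_is k x \<tau> \<Longrightarrow> j = k"
proof (induction j arbitrary: k x \<tau>)
  case 0
  then show ?case by (cases k) auto
next
  case (Suc j)
  then show ?case by (cases k) auto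
qed

lemma measurable_count_is [measurable (raw)]:
  assumes "f \<in> borel_measurable N" "g \<in> measurable N (stream_space borel)"
  shows "Measurable.pred N (\<lambda>w. count_is k (f w) (g w))"
  using assms
proof (induction k arbitrary: f g)
  case 0
  note [measurable] = 0
  show ?case by simp
next
  case (Suc k)
  note [measurable] = Suc.prems
  have [measurable]: "Measurable.pred N (\<lambda>w. count_is k (f w - shd (g w)) (stl (g w)))"
    by (rule Suc.IH) simp_all
  show ?case by simp
qed

lemma measurable_residual [measurable (raw)]:
  assumes "f \<in> borel_measurable N" "g \<in> measurable N (stream_space borel)"
  shows "(\<lambda>w. residual k (f w) (g w)) \<in> measurable N (stream_space borel)"
  using assms
proof (induction k arbitrary: f g)
  case 0
  note [measurable] = 0
  show ?case by simp
next
  case (Suc k)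
  note [measurable] = Suc.prems
  have [measurable]: "(\<lambda>w. residual k (f w - shd (g w)) (stl (g w))) \<in> measurable N (stream_space borel)"
    by (rule Suc.IH) simp_all
  show ?case by simp
qed

definition pois :: "real \<Rightarrow> nat \<Rightarrow> real" where
  "pois r k = r ^ k / fact k * exp (- r)"

lemma pois_nonneg: "0 \<le> r \<Longrightarrow> 0 \<le> pois r k"
  by (simp add: pois_def)

lemma pois_sums: "pois r sums 1"
  using sums_mult2[OF exp_converges[of r], of "exp (- r)"]
  by (simp add: pois_def[abs_def] divide_inverse mult.commute exp_minus_inverse)

lemma pois_measurable [measurable (raw)]:
  assumes [measurable]: "f \<in> borel_measurable N"
  shows "(\<lambda>w. pois (f w) k) \<in> borel_measurable N"
  unfolding pois_def by measurable

definition exp_law :: "real \<Rightarrow> real measure" where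
  "exp_law lam = density lborel (exponential_density lam)"

lemma sets_exp_law [measurable_cong, simp]: "sets (exp_law lam) = sets borel"
  and space_exp_law [simp]: "space (exp_law lam) = UNIV"
  by (simp_all add: exp_law_def)

lemma prob_space_exp_law: "0 < lam \<Longrightarrow> prob_space (exp_law lam)"
  unfolding exp_law_def by (rule prob_space_exponential_density)

text \<open>
  Memorylessness of a single exponential time.
\<close>

lemma exp_law_shift:
  assumes "0 \<le> x" and [measurable]: "\<phi> \<in> borel_measurable borel"
  shows "(\<integral>\<^sup>+t. (if x \<le> t then \<phi> (t - x) else 0) \<partial>exp_law lam)
    = ennreal (pois (lam * x) 0) * (\<integral>\<^sup>+t. \<phi> t \<partial>exp_law lam)"
proof -
  have "(\<integral>\<^sup>+t. (if x \<le> t then \<phi> (t - x) else 0) \<partial>exp_law lam)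
      = (\<integral>\<^sup>+t. ennreal (exponential_density lam t) * (if x \<le> t then \<phi> (t - x) else 0) \<partial>lborel)"
    unfolding exp_law_def by (rule nn_integral_density) simp_all
  also have "\<dots> = (\<integral>\<^sup>+t. ennreal (exponential_density lam (x + t)) * (if 0 \<le> t then \<phi> t else 0) \<partial>lborel)"
    by (subst nn_integral_real_affine[where c = 1 and t = x]) (simp_all cong: if_cong)
  also have "\<dots> = (\<integral>\<^sup>+t. ennreal (exp (- (lam * x))) *
      (ennreal (exponential_density lam t) * \<phi> t) \<partial>lborel)"
  proof (rule nn_integral_cong)
    fix t :: real
    have "exponential_density lam (x + t) = exp (- (lam * x)) * exponential_density lam t" if "0 \<le> t"
      using that assms(1)
      by (simp add: exponential_density_def exp_add[symmetric] algebra_simps)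
    then show "ennreal (exponential_density lam (x + t)) * (if 0 \<le> t then \<phi> t else 0) =
        ennreal (exp (- (lam * x))) * (ennreal (exponential_density lam t) * \<phi> t)"
      by (auto simp: ennreal_mult' mult.assoc exponential_density_def)
  qed
  also have "\<dots> = ennreal (exp (- (lam * x))) *
      (\<integral>\<^sup>+t. ennreal (exponential_density lam t) * \<phi> t \<partial>lborel)"
    by (rule nn_integral_cmult) simp
  also have "(\<integral>\<^sup>+t. ennreal (exponential_density lam t) * \<phi> t \<partial>lborel) = (\<integral>\<^sup>+t. \<phi> t \<partial>exp_law lam)"
    unfolding exp_law_def by (rule nn_integral_density[symmetric]) simp_all
  finally show ?thesis
    by (simp add: pois_def)
qed

text \<open>
  Conditioning on the first arrival \<open>t\<close>: the integrand \<open>exp (- lam * t)\<close> cancels the \<open>t\<close>-dependence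
  of \<open>exp (- lam * (x - t))\<close>, and what remains is the integral of a power.
\<close>

lemma exp_law_convolve_pois:
  assumes "0 \<le> x" and lam: "0 < lam"
  shows "(\<integral>\<^sup>+t. (if t < x then ennreal (pois (lam * (x - t)) k) else 0) \<partial>exp_law lam)
    = ennreal (pois (lam * x) (Suc k))"
proof -
  let ?f = "\<lambda>t. lam * exp (- (lam * x)) * ((lam * (x - t)) ^ k / fact k)"
  let ?F = "\<lambda>t. - exp (- (lam * x)) * ((lam * (x - t)) ^ Suc k / fact (Suc k))"
  have "(\<integral>\<^sup>+t. (if t < x then ennreal (pois (lam * (x - t)) k) else 0) \<partial>exp_law lam)
      = (\<integral>\<^sup>+t. ennreal (exponential_density lam t) *
          (if t < x then ennreal (pois (lam * (x - t)) k) else 0) \<partial>lborel)"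
    unfolding exp_law_def by (rule nn_integral_density) simp_all
  also have "\<dots> = (\<integral>\<^sup>+t. ennreal (?f t) * indicator {0..x} t \<partial>lborel)"
  proof (rule nn_integral_cong_AE)
    show "AE t in lborel. ennreal (exponential_density lam t) *
        (if t < x then ennreal (pois (lam * (x - t)) k) else 0) = ennreal (?f t) * indicator {0..x} t"
      using AE_lborel_singleton[of x]
    proof eventually_elim
      case (elim t)
      have "lam * exp (- (t * lam)) * pois (lam * (x - t)) k = ?f t"
        by (simp add: pois_def exp_add[symmetric] algebra_simps)
      then show ?case
        using elim lam
        by (auto simp: exponential_density_def ennreal_mult'[symmetric] split: split_indicator)
    qed
  qed
  also have "\<dots> = ennreal (?F x - ?F 0)"
  proof (rule nn_integral_FTC_Icc)
    fix t assume t: "t \<in> {0..x}"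
    have "((\<lambda>t. lam * (x - t)) has_real_derivative - lam) (at t)"
      by (auto intro!: derivative_eq_intros)
    from DERIV_cmult[OF DERIV_cdivide[OF DERIV_power[OF this, of "Suc k"], of "fact (Suc k)"],
        of "- exp (- (lam * x))"]
    have "(?F has_real_derivative
        - exp (- (lam * x)) * (real (Suc k) * (- lam * (lam * (x - t)) ^ k) / fact (Suc k))) (at t)"
      by (simp del: power_Suc fact_Suc of_nat_Suc)
    also have "- exp (- (lam * x)) * (real (Suc k) * (- lam * (lam * (x - t)) ^ k) / fact (Suc k)) = ?f t"
      by (simp add: divide_simps)
    finally show "(?F has_real_derivative ?f t) (at t)" .
    show "0 \<le> ?f t"
      using t lam by simp
  qed (use assms in simp_all)
  also have "?F x - ?F 0 = pois (lam * x) (Suc k)"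
    by (simp add: pois_def)
  finally show ?thesis .
qed

text \<open>
  At a fixed time \<open>x\<close> the number of arrivals is Poisson and independent of the residual stream,
  which has the same law as the original one. This is the Markov property of the Poisson process
  at \<open>x\<close>; the induction peels off one arrival at a time.
\<close>

theorem poisson_regeneration:
  assumes lam: "0 < lam" and F: "F \<in> borel_measurable (stream_space borel)" and x: "0 \<le> x"
  shows "(\<integral>\<^sup>+\<tau>. (if count_is k x \<tau> then F (residual k x \<tau>) else 0) \<partial>stream_space (exp_law lam))
    = ennreal (pois (lam * x) k) * (\<integral>\<^sup>+\<tau>. F \<tau> \<partial>stream_space (exp_law lam))"
  using x
proof (induction k arbitrary: x)
  case 0
  interpret E: prob_space "exp_law lam" using lam by (rule prob_space_exp_law)
  interpret Q: prob_space "stream_space (exp_law lam)" by (rule E.prob_space_stream_space)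
  note [measurable] = F
  have "(\<integral>\<^sup>+\<tau>. (if count_is 0 x \<tau> then F (residual 0 x \<tau>) else 0) \<partial>stream_space (exp_law lam))
      = (\<integral>\<^sup>+t. \<integral>\<^sup>+\<tau>. (if x \<le> t then F ((t - x) ## \<tau>) else 0) \<partial>stream_space (exp_law lam) \<partial>exp_law lam)"
    by (subst E.nn_integral_stream_space) (simp_all cong: if_cong)
  also have "\<dots> = (\<integral>\<^sup>+t. (if x \<le> t then (\<lambda>u. \<integral>\<^sup>+\<tau>. F (u ## \<tau>) \<partial>stream_space (exp_law lam)) (t - x) else 0)
      \<partial>exp_law lam)"
    by (intro nn_integral_cong) simp
  also have "\<dots> = ennreal (pois (lam * x) 0) *
      (\<integral>\<^sup>+u. \<integral>\<^sup>+\<tau>. F (u ## \<tau>) \<partial>stream_space (exp_law lam) \<partial>exp_law lam)"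
    by (rule exp_law_shift) (use 0 in simp_all)
  also have "(\<integral>\<^sup>+u. \<integral>\<^sup>+\<tau>. F (u ## \<tau>) \<partial>stream_space (exp_law lam) \<partial>exp_law lam)
      = (\<integral>\<^sup>+\<tau>. F \<tau> \<partial>stream_space (exp_law lam))"
    by (rule E.nn_integral_stream_space[symmetric]) simp
  finally show ?case .
next
  case (Suc k)
  interpret E: prob_space "exp_law lam" using lam by (rule prob_space_exp_law)
  note [measurable] = F
  let ?C = "\<integral>\<^sup>+\<tau>. F \<tau> \<partial>stream_space (exp_law lam)"
  have "(\<integral>\<^sup>+\<tau>. (if count_is (Suc k) x \<tau> then F (residual (Suc k) x \<tau>) else 0) \<partial>stream_space (exp_law lam))
      = (\<integral>\<^sup>+t. \<integral>\<^sup>+\<tau>. (if t < x \<and> count_is k (x - t) \<tau> then F (residual k (x - t) \<tau>) else 0)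
          \<partial>stream_space (exp_law lam) \<partial>exp_law lam)"
    by (subst E.nn_integral_stream_space) (simp_all cong: if_cong)
  also have "\<dots> = (\<integral>\<^sup>+t. (if t < x then ennreal (pois (lam * (x - t)) k) else 0) * ?C \<partial>exp_law lam)"
    by (intro nn_integral_cong) (simp add: Suc.IH)
  also have "\<dots> = (\<integral>\<^sup>+t. (if t < x then ennreal (pois (lam * (x - t)) k) else 0) \<partial>exp_law lam) * ?C"
    by (rule nn_integral_multc) simp
  finally show ?case
    using exp_law_convolve_pois[OF Suc.prems lam] by simp
qed

section \<open>Costs of a sequence of services\<close>

text \<open>
  Total cost of at most \<open>m\<close> services, starting with \<open>i\<close> messages in the system, when a service that
  begins with \<open>i\<close> messages and sees \<open>k\<close> arrivals costs \<open>r i k\<close>. Costs stop when the system is empty.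
  The sum over \<open>k\<close> has at most one nonzero term; written in this way it is measurable
  and its integral is accessible to \<open>poisson_regeneration\<close>.
\<close>

primrec cost :: "nat \<Rightarrow> (nat \<Rightarrow> nat \<Rightarrow> ennreal) \<Rightarrow> nat \<Rightarrow> nat \<Rightarrow> real stream \<Rightarrow> real stream \<Rightarrow> ennreal" where
  "cost n r 0 i \<tau> \<sigma> = 0"
| "cost n r (Suc m) i \<tau> \<sigma> = (if i = 0 then 0 else
     (\<Sum>k. if count_is k (shd \<sigma>) \<tau>
       then r i k + cost n r m (min (i - 1 + k) n) (residual k (shd \<sigma>) \<tau>) (stl \<sigma>) else 0))"

lemma measurable_cost [measurable (raw)]:
  assumes "f \<in> measurable N (stream_space borel)" "g \<in> measurable N (stream_space borel)"
  shows "(\<lambda>w. cost n r m i (f w) (g w)) \<in> borel_measurable N"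
  using assms
proof (induction m arbitrary: i f g)
  case (Suc m)
  note [measurable] = Suc.prems
  have [measurable]: "(\<lambda>w. cost n r m j (residual k (shd (g w)) (f w)) (stl (g w))) \<in> borel_measurable N"
    for j k by (rule Suc.IH) simp_all
  show ?case by simp
qed simp

lemma cost_mono: "cost n r m i \<tau> \<sigma> \<le> cost n r (Suc m) i \<tau> \<sigma>"
proof (induction m arbitrary: i \<tau> \<sigma>)
  case (Suc m)
  show ?case
    by (subst (1 2) cost.simps(2)) (auto intro!: suminf_le add_left_mono Suc.IH simp del: cost.simps)
qed simp

section \<open>The number of arrivals during a service\<close>

locale poisson_input =
  fixes lam :: real and B :: "real measure"
  assumes lam_pos: "0 < lam" and B_law: "real_distribution B" and B_nonneg: "AE x in B. 0 \<le> x"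
begin

sublocale B: real_distribution B by (rule B_law)
sublocale E: prob_space "exp_law lam" using lam_pos by (rule prob_space_exp_law)
sublocale \<tau>: prob_space "stream_space (exp_law lam)" by (rule E.prob_space_stream_space)
sublocale \<sigma>: prob_space "stream_space B" by (rule B.prob_space_stream_space)

definition arrivals_prob :: "nat \<Rightarrow> real" where
  "arrivals_prob k = (\<integral>x. pois (lam * x) k \<partial>B)"

lemma AE_pois_nonneg: "AE x in B. 0 \<le> pois (lam * x) k"
  using B_nonneg by eventually_elim (use lam_pos in \<open>simp add: pois_nonneg\<close>)

lemma pois_le_1: "0 \<le> r \<Longrightarrow> pois r k \<le> 1"
  using sum_le_suminf[of "pois r" "{k}"] pois_sums[of r] by (simp add: sums_iff pois_nonneg)

lemma nn_integral_pois: "(\<integral>\<^sup>+x. ennreal (pois (lam * x) k) \<partial>B) = ennreal (arrivals_prob k)"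
  unfolding arrivals_prob_def
proof (rule nn_integral_eq_integral)
  show "integrable B (\<lambda>x. pois (lam * x) k)"
  proof (rule B.integrable_const_bound[where B = 1])
    show "AE x in B. norm (pois (lam * x) k) \<le> 1"
      using B_nonneg by eventually_elim (use lam_pos in \<open>simp add: pois_nonneg pois_le_1\<close>)
  qed simp
qed (rule AE_pois_nonneg)

lemma arrivals_prob_nonneg: "0 \<le> arrivals_prob k"
  unfolding arrivals_prob_def by (rule integral_nonneg_AE) (rule AE_pois_nonneg)

lemma nn_integral_weighted_pois:
  fixes w :: "nat \<Rightarrow> ennreal"
  shows "(\<Sum>k. ennreal (arrivals_prob k) * w k) = (\<integral>\<^sup>+x. (\<Sum>k. ennreal (pois (lam * x) k) * w k) \<partial>B)"
  by (subst nn_integral_suminf) (simp_all add: nn_integral_multc nn_integral_pois)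

definition arrivals :: "nat pmf" where
  "arrivals = embed_pmf arrivals_prob"

lemma suminf_pois_ennreal: "0 \<le> r \<Longrightarrow> (\<Sum>k. ennreal (pois r k)) = 1"
  using suminf_ennreal_eq[OF pois_nonneg pois_sums] by simp

lemma pmf_arrivals: "pmf arrivals k = arrivals_prob k"
  unfolding arrivals_def
proof (rule pmf_embed_pmf)
  have "(\<integral>\<^sup>+k. ennreal (arrivals_prob k) \<partial>count_space UNIV) = (\<integral>\<^sup>+x. (\<Sum>k. ennreal (pois (lam * x) k)) \<partial>B)"
    using nn_integral_weighted_pois[of "\<lambda>_. 1"] by (simp add: nn_integral_count_space_nat)
  also have "\<dots> = (\<integral>\<^sup>+x. 1 \<partial>B)"
    using B_nonneg by (intro nn_integral_cong_AE, eventually_elim)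
      (use lam_pos in \<open>simp add: suminf_pois_ennreal\<close>)
  finally show "(\<integral>\<^sup>+k. ennreal (arrivals_prob k) \<partial>count_space UNIV) = 1"
    using B.emeasure_space_1 by simp
qed (rule arrivals_prob_nonneg)

lemma nn_integral_arrivals:
  "(\<integral>\<^sup>+k. w k \<partial>arrivals) = (\<Sum>k. ennreal (arrivals_prob k) * w k)"
  by (simp add: nn_integral_measure_pmf nn_integral_count_space_nat pmf_arrivals)

lemma nn_integral_arrivals_B:
  "(\<integral>\<^sup>+k. w k \<partial>arrivals) = (\<integral>\<^sup>+x. (\<Sum>k. ennreal (pois (lam * x) k) * w k) \<partial>B)"
  by (simp add: nn_integral_arrivals nn_integral_weighted_pois)

text \<open>
  Almost surely only finitely many arrivals occur before \<open>x\<close>, as the Poisson probabilities add up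
  to \<open>1\<close>, and none occurs at \<open>x\<close>, as the first residual gap is exponential.
\<close>

lemma AE_count_is:
  assumes "0 \<le> x"
  shows "AE \<tau> in stream_space (exp_law lam). \<exists>k. count_is k x \<tau> \<and> shd (residual k x \<tau>) \<noteq> 0"
proof -
  let ?Q = "stream_space (exp_law lam)"
  (* With this test function the regeneration property counts the residual streams that do
     not start with an arrival. *)
  let ?F = "\<lambda>\<tau>. if shd \<tau> \<noteq> 0 then 1 else 0 :: ennreal"
  have m [measurable]: "Measurable.pred ?Q (count_is k x)" for k
    by (rule measurable_count_is) simp_all
  have m' [measurable]: "residual k x \<in> measurable ?Q (stream_space borel)" for k
    by (rule measurable_residual) simp_all
  have "AE t in exp_law lam. t \<noteq> 0"
    unfolding exp_law_def
    by (subst AE_density) (use AE_lborel_singleton[of 0] in \<open>auto elim!: eventually_mono\<close>)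
  then have "AE \<tau> in ?Q. shd \<tau> \<noteq> 0"
    by (subst E.AE_stream_space) auto
  then have "(\<integral>\<^sup>+\<tau>. ?F \<tau> \<partial>?Q) = (\<integral>\<^sup>+\<tau>. 1 \<partial>?Q)"
    by (intro nn_integral_cong_AE) (auto elim!: eventually_mono)
  then have F: "(\<integral>\<^sup>+\<tau>. ?F \<tau> \<partial>?Q) = 1"
    using \<tau>.emeasure_space_1 by simp
  have "emeasure ?Q {\<tau> \<in> space ?Q. \<exists>k. count_is k x \<tau> \<and> shd (residual k x \<tau>) \<noteq> 0} =
      (\<integral>\<^sup>+\<tau>. indicator {\<tau> \<in> space ?Q. \<exists>k. count_is k x \<tau> \<and> shd (residual k x \<tau>) \<noteq> 0} \<tau> \<partial>?Q)"
    by (rule nn_integral_indicator[symmetric]) measurable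
  also have "\<dots> = (\<integral>\<^sup>+\<tau>. (\<Sum>k. if count_is k x \<tau> then ?F (residual k x \<tau>) else 0) \<partial>?Q)"
  proof (rule nn_integral_cong)
    fix \<tau> assume \<tau>: "\<tau> \<in> space ?Q"
    show "indicator {\<tau> \<in> space ?Q. \<exists>k. count_is k x \<tau> \<and> shd (residual k x \<tau>) \<noteq> 0} \<tau> =
        (\<Sum>k. if count_is k x \<tau> then ?F (residual k x \<tau>) else 0)"
    proof (cases "\<exists>k. count_is k x \<tau>")
      case True
      then obtain k where k: "count_is k x \<tau>" by blast
      then have eq: "count_is j x \<tau> \<longleftrightarrow> j = k" for j
        using count_is_unique by blast
      show ?thesis
        using \<tau> by (subst suminf_finite[of "{k}"]) (auto simp: eq)
    qed simp
  qed
  also have "\<dots> = (\<Sum>k. \<integral>\<^sup>+\<tau>. (if count_is k x \<tau> then ?F (residual k x \<tau>) else 0) \<partial>?Q)"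
    by (rule nn_integral_suminf) measurable
  also have "\<dots> = (\<Sum>k. ennreal (pois (lam * x) k) * (\<integral>\<^sup>+\<tau>. ?F \<tau> \<partial>?Q))"
    by (intro suminf_cong poisson_regeneration lam_pos assms) measurable
  also have "\<dots> = 1"
    using assms lam_pos by (simp add: F suminf_pois_ennreal)
  finally show ?thesis
    by (intro \<tau>.AE_I_eq_1) measurable
qed

section \<open>Mean costs until the system empties\<close>

definition mean_cost :: "nat \<Rightarrow> (nat \<Rightarrow> nat \<Rightarrow> ennreal) \<Rightarrow> nat \<Rightarrow> nat \<Rightarrow> ennreal" where
  "mean_cost n r m i =
    (\<integral>\<^sup>+\<sigma>. \<integral>\<^sup>+\<tau>. cost n r m i \<tau> \<sigma> \<partial>stream_space (exp_law lam) \<partial>stream_space B)"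

lemma mean_cost_0: "mean_cost n r 0 i = 0"
  by (simp add: mean_cost_def)

lemma mean_cost_idle: "mean_cost n r m 0 = 0"
  by (cases m) (simp_all add: mean_cost_def)

text \<open>
  First step analysis: integrate over the first service time and use \<open>poisson_regeneration\<close>. The
  remaining service times and the residual gaps have the original law.
\<close>

theorem mean_cost_Suc:
  assumes "0 < i"
  shows "mean_cost n r (Suc m) i = (\<integral>\<^sup>+k. (r i k + mean_cost n r m (min (i - 1 + k) n)) \<partial>arrivals)"
proof -
  let ?Q = "stream_space (exp_law lam)"
  let ?next = "\<lambda>k. min (i - 1 + k) n"
  have cost_\<tau> [measurable]: "(\<lambda>\<tau>. cost n r m j \<tau> \<sigma>) \<in> borel_measurable (stream_space borel)" for j \<sigma>
    by (intro measurable_cost) (simp_all add: space_stream_space)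
  have one_service: "(\<integral>\<^sup>+\<tau>. cost n r (Suc m) i \<tau> (x ## \<sigma>) \<partial>?Q)
      = (\<Sum>k. ennreal (pois (lam * x) k) * (r i k + (\<integral>\<^sup>+\<tau>. cost n r m (?next k) \<tau> \<sigma> \<partial>?Q)))"
    if "0 \<le> x" for x \<sigma>
  proof -
    have "(\<integral>\<^sup>+\<tau>. cost n r (Suc m) i \<tau> (x ## \<sigma>) \<partial>?Q) = (\<integral>\<^sup>+\<tau>. (\<Sum>k. if count_is k x \<tau>
        then r i k + cost n r m (?next k) (residual k x \<tau>) \<sigma> else 0) \<partial>?Q)"
      using assms by (simp cong: if_cong)
    also have "\<dots> = (\<Sum>k. \<integral>\<^sup>+\<tau>. (if count_is k x \<tau>
        then r i k + cost n r m (?next k) (residual k x \<tau>) \<sigma> else 0) \<partial>?Q)"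
    proof (rule nn_integral_suminf)
      fix k
      have [measurable]: "Measurable.pred ?Q (count_is k x)"
        by (rule measurable_count_is) simp_all
      have [measurable]: "(\<lambda>\<tau>. cost n r m (?next k) (residual k x \<tau>) \<sigma>) \<in> borel_measurable ?Q"
        by (intro measurable_compose[OF _ cost_\<tau>] measurable_residual) simp_all
      show "(\<lambda>\<tau>. if count_is k x \<tau> then r i k + cost n r m (?next k) (residual k x \<tau>) \<sigma> else 0)
          \<in> borel_measurable ?Q"
        by measurable
    qed
    also have "\<dots> = (\<Sum>k. ennreal (pois (lam * x) k) *
        (\<integral>\<^sup>+\<tau>. r i k + cost n r m (?next k) \<tau> \<sigma> \<partial>?Q))"
      by (intro suminf_cong poisson_regeneration[OF lam_pos _ that]) simp
    finally show ?thesis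
      by (simp add: nn_integral_add \<tau>.emeasure_space_1)
  qed
  have "mean_cost n r (Suc m) i =
      (\<integral>\<^sup>+x. \<integral>\<^sup>+\<sigma>. \<integral>\<^sup>+\<tau>. cost n r (Suc m) i \<tau> (x ## \<sigma>) \<partial>?Q \<partial>stream_space B \<partial>B)"
    unfolding mean_cost_def by (subst B.nn_integral_stream_space) (simp_all del: cost.simps)
  also have "\<dots> = (\<integral>\<^sup>+x. (\<Sum>k. ennreal (pois (lam * x) k) * (r i k + mean_cost n r m (?next k))) \<partial>B)"
  proof (rule nn_integral_cong_AE)
    show "AE x in B. (\<integral>\<^sup>+\<sigma>. \<integral>\<^sup>+\<tau>. cost n r (Suc m) i \<tau> (x ## \<sigma>) \<partial>?Q \<partial>stream_space B)
        = (\<Sum>k. ennreal (pois (lam * x) k) * (r i k + mean_cost n r m (?next k)))"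
      using B_nonneg
    proof eventually_elim
      case (elim x)
      then show ?case
        unfolding one_service[OF elim]
        by (simp add: nn_integral_suminf nn_integral_cmult nn_integral_add \<sigma>.emeasure_space_1 mean_cost_def)
    qed
  qed
  also have "\<dots> = (\<integral>\<^sup>+k. (r i k + mean_cost n r m (?next k)) \<partial>arrivals)"
    by (simp add: nn_integral_arrivals_B)
  finally show ?thesis .
qed

end

context poisson_input
begin

lemma mean_cost_mono: "mean_cost n r m i \<le> mean_cost n r (Suc m) i"
proof (induction m arbitrary: i)
  case (Suc m)
  show ?case
  proof (cases "i = 0")
    case False
    then show ?thesis
      by (simp add: mean_cost_Suc) (intro nn_integral_mono add_mono order_refl Suc.IH)
  qed (simp add: mean_cost_idle)
qed (simp add: mean_cost_0)

lemma SUP_mean_cost_eq: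
  assumes "0 < i"
  shows "(SUP m. mean_cost n r m i) =
    (\<integral>\<^sup>+k. (r i k + (SUP m. mean_cost n r m (min (i - 1 + k) n))) \<partial>arrivals)"
proof -
  have incseq: "incseq (\<lambda>m. mean_cost n r m j)" for j
    by (rule incseq_SucI) (rule mean_cost_mono)
  have "(SUP m. mean_cost n r m i) = (SUP m. mean_cost n r (Suc m) i)"
    by (intro antisym SUP_mono) (use mean_cost_mono in blast)+
  also have "\<dots> = (SUP m. \<integral>\<^sup>+k. (r i k + mean_cost n r m (min (i - 1 + k) n)) \<partial>arrivals)"
    using assms by (simp add: mean_cost_Suc)
  also have "\<dots> = (\<integral>\<^sup>+k. (SUP m. r i k + mean_cost n r m (min (i - 1 + k) n)) \<partial>arrivals)"
    by (rule nn_integral_monotone_convergence_SUP[symmetric])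
      (auto simp: incseq_def le_fun_def intro!: add_left_mono incseqD[OF incseq])
  also have "\<dots> = (\<integral>\<^sup>+k. (r i k + (SUP m. mean_cost n r m (min (i - 1 + k) n))) \<partial>arrivals)"
    by (simp add: ennreal_SUP_add_right)
  finally show ?thesis .
qed

text \<open>
  Any nonnegative solution \<open>g\<close> of the first step equations is the mean cost until the system is
  empty. The mean cost is the least solution, so the difference \<open>d\<close> is nonnegative; it is harmonic
  for the chain and vanishes at \<open>0\<close>. Were its maximum positive, then at the least state attaining it
  a service without arrivals, which has positive probability, would lead to a smaller value.
\<close>

theorem SUP_mean_cost:
  fixes g :: "nat \<Rightarrow> real"
  assumes g0: "g 0 = 0" and g_nonneg: "\<And>i. i \<le> n \<Longrightarrow> 0 \<le> g i"
    and g_eq: "\<And>i. 0 < i \<Longrightarrow> i \<le> n \<Longrightarrow>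
      ennreal (g i) = (\<integral>\<^sup>+k. (r i k + ennreal (g (min (i - 1 + k) n))) \<partial>arrivals)"
    and idle_pos: "0 < pmf arrivals 0" and "i \<le> n"
  shows "(SUP m. mean_cost n r m i) = ennreal (g i)"
proof -
  have le_g: "mean_cost n r m j \<le> ennreal (g j)" if "j \<le> n" for m j
    using that
  proof (induction m arbitrary: j)
    case (Suc m)
    show ?case
    proof (cases "j = 0")
      case False
      then show ?thesis
        using Suc.prems
        by (simp add: mean_cost_Suc g_eq) (intro nn_integral_mono add_mono order_refl Suc.IH, simp)
    qed (simp add: mean_cost_idle)
  qed (simp add: mean_cost_0)
  define h where "h j = enn2real (SUP m. mean_cost n r m j)" for j
  have h_ennreal: "(SUP m. mean_cost n r m j) = ennreal (h j)" if "j \<le> n" for j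
  proof -
    have "(SUP m. mean_cost n r m j) \<le> ennreal (g j)"
      by (rule SUP_least) (rule le_g[OF that])
    then have "(SUP m. mean_cost n r m j) < top"
      using ennreal_less_top le_less_trans by blast
    then show ?thesis by (simp add: h_def)
  qed
  have h_le: "h j \<le> g j" if "j \<le> n" for j
  proof -
    have "ennreal (h j) \<le> ennreal (g j)"
      unfolding h_ennreal[OF that, symmetric] by (rule SUP_least) (rule le_g[OF that])
    then show ?thesis using g_nonneg[OF that] by simp
  qed
  have h_nonneg: "0 \<le> h j" for j by (simp add: h_def)
  define K where "K = (\<Sum>j\<le>n. g j)"
  have K: "g j \<le> K" if "j \<le> n" for j
    unfolding K_def using that g_nonneg by (intro member_le_sum) auto
  have int: "integrable (measure_pmf arrivals) (\<lambda>k. f (min (i - 1 + k) n))"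
    if "\<And>j. j \<le> n \<Longrightarrow> 0 \<le> f j \<and> f j \<le> K" for f :: "nat \<Rightarrow> real" and i
    using that by (intro measure_pmf.integrable_const_bound[where B = K]) auto
  have eq: "\<exists>R. \<forall>f\<in>{g, h}. f j = R + measure_pmf.expectation arrivals (\<lambda>k. f (min (j - 1 + k) n))"
    if j: "0 < j" "j \<le> n" for j
  proof -
    define R where "R = (\<integral>\<^sup>+k. r j k \<partial>arrivals)"
    have "ennreal (f j) = R + ennreal (measure_pmf.expectation arrivals (\<lambda>k. f (min (j - 1 + k) n)))"
      if f: "f \<in> {g, h}" for f
    proof -
      have "ennreal (f j) = (\<integral>\<^sup>+k. (r j k + ennreal (f (min (j - 1 + k) n))) \<partial>arrivals)"
        using f g_eq[OF j] SUP_mean_cost_eq[OF j(1), of n r] j(2) by (auto simp: h_ennreal)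
      also have "\<dots> = R + (\<integral>\<^sup>+k. ennreal (f (min (j - 1 + k) n)) \<partial>arrivals)"
        by (simp add: R_def nn_integral_add)
      also have "(\<integral>\<^sup>+k. ennreal (f (min (j - 1 + k) n)) \<partial>arrivals) =
          ennreal (measure_pmf.expectation arrivals (\<lambda>k. f (min (j - 1 + k) n)))"
        using f g_nonneg h_nonneg K h_le order_trans[OF h_le K]
        by (intro nn_integral_eq_integral int) auto
      finally show ?thesis .
    qed
    note R = this
    have "R \<noteq> top"
      using R[of g] by (metis ennreal_neq_top ennreal_add_eq_top insertI1)
    then obtain R' where R': "0 \<le> R'" "R = ennreal R'"
      by (cases R) auto
    have "f j = R' + measure_pmf.expectation arrivals (\<lambda>k. f (min (j - 1 + k) n))"
      if f: "f \<in> {g, h}" for f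
    proof -
      have "0 \<le> measure_pmf.expectation arrivals (\<lambda>k. f (min (j - 1 + k) n))"
        using f g_nonneg h_nonneg by (intro integral_nonneg_AE AE_I2) auto
      moreover have "0 \<le> f j"
        using f g_nonneg h_nonneg j by auto
      ultimately show ?thesis
        using R[OF f] R' by (simp flip: ennreal_plus)
    qed
    then show ?thesis by blast
  qed
  define d where "d j = g j - h j" for j
  define Mx where "Mx = Max (d ` {..n})"
  have d_le: "d j \<le> Mx" if "j \<le> n" for j
    unfolding Mx_def using that by (intro Max_ge) auto
  have "Mx \<in> d ` {..n}"
    unfolding Mx_def by (rule Max_in) auto
  then have ex: "\<exists>j\<le>n. d j = Mx" by auto
  (* The least state at which the maximum of d is attained. *)
  define j where "j = (LEAST j. j \<le> n \<and> d j = Mx)"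
  have j: "j \<le> n" "d j = Mx"
    using LeastI_ex[OF ex[unfolded Bex_def]] by (auto simp: j_def)
  have "j = 0"
  proof (rule ccontr)
    assume "j \<noteq> 0"
    then have "0 < j" by simp
    have below: "d (j - 1) < Mx"
      using not_less_Least[of "j - 1" "\<lambda>j. j \<le> n \<and> d j = Mx"] d_le[of "j - 1"] j(1) \<open>0 < j\<close>
      unfolding j_def[symmetric] by fastforce
    let ?next = "\<lambda>k. min (j - 1 + k) n"
    have int_g: "integrable (measure_pmf arrivals) (\<lambda>k. g (?next k))"
      and int_h: "integrable (measure_pmf arrivals) (\<lambda>k. h (?next k))"
      using g_nonneg h_nonneg K order_trans[OF h_le K] by (intro int; simp)+
    have "Mx = measure_pmf.expectation arrivals (\<lambda>k. d (?next k))"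
      using eq[OF \<open>0 < j\<close> j(1)] int_g int_h j(2) by (auto simp: d_def)
    then have zero: "measure_pmf.expectation arrivals (\<lambda>k. Mx - d (?next k)) = 0"
      using int_g int_h by (simp add: d_def)
    have "AE k in measure_pmf arrivals. Mx - d (?next k) = 0"
    proof (subst integral_nonneg_eq_0_iff_AE[symmetric])
      show "integrable (measure_pmf arrivals) (\<lambda>k. Mx - d (?next k))"
        using int_g int_h unfolding d_def by simp
    qed (use d_le zero in auto)
    moreover have "0 \<in> set_pmf arrivals"
      using idle_pos by (simp add: set_pmf_iff)
    ultimately have "Mx - d (?next 0) = 0"
      by (auto simp: AE_measure_pmf_iff)
    then show False
      using below j(1) by (simp add: min_def split: if_splits)
  qed
  then have "Mx = 0"
    using j(2) g0 by (simp add: d_def h_def mean_cost_idle)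
  then show ?thesis
    using d_le[OF \<open>i \<le> n\<close>] h_le[OF \<open>i \<le> n\<close>] h_ennreal[OF \<open>i \<le> n\<close>] by (simp add: d_def)
qed

section \<open>Moments of the number of arrivals\<close>

lemma pmf_arrivals_0_pos: "0 < pmf arrivals 0"
proof -
  have "arrivals_prob 0 \<noteq> 0"
  proof
    assume "arrivals_prob 0 = 0"
    then have "(\<integral>\<^sup>+x. ennreal (pois (lam * x) 0) \<partial>B) = 0"
      by (simp add: nn_integral_pois)
    then have "AE x in B. False"
      by (subst (asm) nn_integral_0_iff_AE) (simp_all add: pois_def)
    then show False by simp
  qed
  then show ?thesis
    using arrivals_prob_nonneg[of 0] by (simp add: pmf_arrivals)
qed

text \<open>
  Two arrivals during a service are possible unless services take no time. This makes the
  renewal sequence below aperiodic.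
\<close>

lemma pmf_arrivals_2_pos:
  assumes "(\<integral>x. x \<partial>B) \<noteq> 0"
  shows "0 < pmf arrivals 2"
proof -
  have "arrivals_prob 2 \<noteq> 0"
  proof
    assume "arrivals_prob 2 = 0"
    then have "(\<integral>\<^sup>+x. ennreal (pois (lam * x) 2) \<partial>B) = 0"
      by (simp add: nn_integral_pois)
    then have "AE x in B. ennreal (pois (lam * x) 2) = 0"
      by (subst (asm) nn_integral_0_iff_AE) simp_all
    then have "AE x in B. x = 0"
      using B_nonneg
    proof eventually_elim
      case (elim x)
      then have "pois (lam * x) 2 = 0"
        using pois_nonneg[of "lam * x" 2] lam_pos by simp
      then show ?case
        using lam_pos by (simp add: pois_def)
    qed
    then have "(\<integral>x. x \<partial>B) = (\<integral>x. 0 \<partial>B)"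
      by (intro integral_cong_AE) simp_all
    with assms show False by simp
  qed
  then show ?thesis
    using arrivals_prob_nonneg[of 2] by (simp add: pmf_arrivals)
qed

lemma pois_mean_sums: "(\<lambda>k. pois r k * real k) sums r"
proof -
  have "pois r (Suc k) * real (Suc k) = pois r k * r" for k
    by (simp add: pois_def divide_simps del: of_nat_Suc)
  then show ?thesis
    using sums_mult2[OF pois_sums[of r], of r] sums_Suc_iff[of "\<lambda>k. pois r k * real k" r] by simp
qed

lemma pois_factorial_moment_sums: "(\<lambda>k. pois r k * (real k * (real k - 1) / 2)) sums (r ^ 2 / 2)"
proof -
  let ?w = "\<lambda>k. pois r k * (real k * (real k - 1) / 2)"
  have "?w (Suc k) = pois r k * real k * (r / 2)" for k
    by (simp add: pois_def divide_simps del: of_nat_Suc)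
  moreover have "(\<lambda>k. pois r k * real k * (r / 2)) sums (r ^ 2 / 2)"
    using sums_mult2[OF pois_mean_sums[of r], of "r / 2"] by (simp add: power2_eq_square)
  ultimately have "(\<lambda>k. ?w (Suc k)) sums (r ^ 2 / 2)"
    by (simp only:)
  then show ?thesis
    using sums_Suc_iff[of ?w "r ^ 2 / 2"] by simp
qed

lemma real_pairs_nonneg: "0 \<le> real k * (real k - 1) / 2"
  by (cases k) simp_all

text \<open>
  Moments of a mixed Poisson law are mixtures of the Poisson moments \<open>W\<close>.
\<close>

lemma nn_integral_arrivals_moment:
  fixes w :: "nat \<Rightarrow> real"
  assumes w: "\<And>k. 0 \<le> w k" and sums: "\<And>r. 0 \<le> r \<Longrightarrow> (\<lambda>k. pois r k * w k) sums W r"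
    and int: "integrable B (\<lambda>x. W (lam * x))"
  shows "(\<integral>\<^sup>+k. ennreal (w k) \<partial>arrivals) = ennreal (\<integral>x. W (lam * x) \<partial>B)"
proof -
  have W_eq: "(\<Sum>k. ennreal (pois r k) * ennreal (w k)) = ennreal (W r)" and W_nonneg: "0 \<le> W r"
    if "0 \<le> r" for r
  proof -
    have "(\<Sum>k. ennreal (pois r k) * ennreal (w k)) = (\<Sum>k. ennreal (pois r k * w k))"
      using that w by (simp add: ennreal_mult pois_nonneg)
    also have "\<dots> = ennreal (W r)"
      by (rule suminf_ennreal_eq[OF _ sums[OF that]]) (simp add: that w pois_nonneg)
    finally show "(\<Sum>k. ennreal (pois r k) * ennreal (w k)) = ennreal (W r)" .
    show "0 \<le> W r"
      by (rule sums_le[OF _ sums_zero sums[OF that]]) (simp add: that w pois_nonneg)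
  qed
  have "(\<integral>\<^sup>+k. ennreal (w k) \<partial>arrivals) = (\<integral>\<^sup>+x. ennreal (W (lam * x)) \<partial>B)"
    unfolding nn_integral_arrivals_B
  proof (rule nn_integral_cong_AE)
    show "AE x in B. (\<Sum>k. ennreal (pois (lam * x) k) * ennreal (w k)) = ennreal (W (lam * x))"
      using B_nonneg by eventually_elim (use lam_pos in \<open>simp add: W_eq\<close>)
  qed
  also have "\<dots> = ennreal (\<integral>x. W (lam * x) \<partial>B)"
  proof (rule nn_integral_eq_integral[OF int])
    show "AE x in B. 0 \<le> W (lam * x)"
      using B_nonneg by eventually_elim (use lam_pos in \<open>simp add: W_nonneg\<close>)
  qed
  finally show ?thesis .
qed

lemma nn_integral_arrivals_mean:
  assumes "integrable B (\<lambda>x. x)"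
  shows "(\<integral>\<^sup>+k. ennreal (real k) \<partial>arrivals) = ennreal (rho lam B 1)"
  using nn_integral_arrivals_moment[of real "\<lambda>r. r"] pois_mean_sums assms by (simp add: rho_def)

lemma nn_integral_arrivals_pairs:
  assumes "integrable B (\<lambda>x. x ^ 2)"
  shows "(\<integral>\<^sup>+k. ennreal (real k * (real k - 1) / 2) \<partial>arrivals) = ennreal (rho lam B 2 / 2)"
  using nn_integral_arrivals_moment[of "\<lambda>k. real k * (real k - 1) / 2" "\<lambda>r. r ^ 2 / 2"]
    pois_factorial_moment_sums real_pairs_nonneg assms by (simp add: rho_def power_mult_distrib)

end

section \<open>Mean counts at critical load\<close>

locale critical_input = poisson_input +
  assumes B_integrable: "integrable B (\<lambda>x. x)" and critical: "rho lam B 1 = 1"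
    and B_square_integrable: "integrable B (\<lambda>x. x ^ 2)"
begin

abbreviation "pi0 \<equiv> pmf arrivals 0"

definition tail :: "nat \<Rightarrow> real" where
  "tail j = measure_pmf.prob arrivals {k. j < k}"

text \<open>
  Up to normalisation this is the tail function of the renewal distances. The closed form as a mean
  makes its sum, the mean distance, a binomial moment of the number of arrivals.
\<close>

definition excess :: "nat \<Rightarrow> real" where
  "excess j = measure_pmf.expectation arrivals (\<lambda>k. real (k - 1 - j))"

lemma integrable_arrivals: "integrable (measure_pmf arrivals) real"
  and mean_arrivals: "measure_pmf.expectation arrivals real = 1"
proof -
  have "(\<integral>\<^sup>+k. ennreal (real k) \<partial>arrivals) = ennreal 1"
    using nn_integral_arrivals_mean[OF B_integrable] critical by simp
  then have "has_bochner_integral (measure_pmf arrivals) real 1"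
    by (intro has_bochner_integral_nn_integral) simp_all
  then show "integrable (measure_pmf arrivals) real" "measure_pmf.expectation arrivals real = 1"
    by (auto simp: has_bochner_integral_iff)
qed

lemma integrable_le_arrivals:
  assumes "\<And>k. \<bar>f k\<bar> \<le> real k + c"
  shows "integrable (measure_pmf arrivals) f"
proof (rule Bochner_Integration.integrable_bound)
  show "integrable (measure_pmf arrivals) (\<lambda>k. real k + c)"
    using integrable_arrivals by simp
  show "AE k in measure_pmf arrivals. norm (f k) \<le> norm (real k + c)"
    using assms by (auto simp: AE_measure_pmf_iff intro: order_trans[OF assms abs_ge_self])
qed simp

lemma integrable_excess: "integrable (measure_pmf arrivals) (\<lambda>k. real (k - 1 - j))"
  by (rule integrable_le_arrivals[of _ 0]) simp

lemma tail_nonneg: "0 \<le> tail j"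
  by (simp add: tail_def)

lemma expectation_tail: "measure_pmf.expectation arrivals (\<lambda>k. of_bool (j < k)) = tail j"
proof -
  have "(\<lambda>k. of_bool (j < k) :: real) = indicator {k. j < k}"
    by (auto simp: fun_eq_iff)
  then show ?thesis by (simp add: tail_def)
qed

lemma integrable_of_bool: "integrable (measure_pmf arrivals) (\<lambda>k. of_bool (Q k) :: real)"
  by (rule measure_pmf.integrable_const_bound[where B = 1]) auto

lemma tail_0: "tail 0 = 1 - pi0"
proof -
  have "tail 0 = measure_pmf.prob arrivals (space (measure_pmf arrivals) - {0})"
    unfolding tail_def by (rule arg_cong[where f = "measure _"]) auto
  also have "\<dots> = 1 - pi0"
    by (subst measure_pmf.prob_compl) (simp_all add: measure_pmf_single)
  finally show ?thesis .
qed

lemma excess_0: "excess 0 = pi0"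
proof -
  have "excess 0 = measure_pmf.expectation arrivals (\<lambda>k. real k - of_bool (0 < k))"
    unfolding excess_def by (rule Bochner_Integration.integral_cong) auto
  also have "\<dots> = 1 - tail 0"
    using integrable_arrivals integrable_of_bool by (simp add: mean_arrivals expectation_tail)
  finally show ?thesis by (simp add: tail_0)
qed

lemma excess_Suc: "excess (Suc j) = excess j - tail (Suc j)"
proof -
  have "excess (Suc j) = measure_pmf.expectation arrivals (\<lambda>k. real (k - 1 - j) - of_bool (Suc j < k))"
    unfolding excess_def by (rule Bochner_Integration.integral_cong) auto
  then show ?thesis
    using integrable_excess integrable_of_bool by (simp add: expectation_tail excess_def)
qed

lemma excess_nonneg: "0 \<le> excess j"
  unfolding excess_def by (rule integral_nonneg_AE) simp

text \<open>
  Summing \<open>k - 1 - j\<close> over \<open>j\<close> gives the triangular number \<open>k * (k - 1) / 2\<close>.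
\<close>

lemma excess_sums: "excess sums (rho lam B 2 / 2)"
proof -
  have triangle: "(\<Sum>j. ennreal (real (k - 1 - j))) = ennreal (real k * (real k - 1) / 2)" for k
  proof -
    have "(\<Sum>j. ennreal (real (k - 1 - j))) = (\<Sum>j<k. ennreal (real (k - 1 - j)))"
      by (rule suminf_finite) auto
    also have "\<dots> = ennreal (\<Sum>j<k. real (k - 1 - j))"
      by (rule sum_ennreal) simp
    also have "(\<Sum>j<k. real (k - 1 - j)) = (\<Sum>j<k. real j)"
      using sum.nat_diff_reindex[of real k] by simp
    also have "\<dots> = real k * (real k - 1) / 2"
      by (induction k) (simp_all add: field_simps)
    finally show ?thesis .
  qed
  have "(\<Sum>j. ennreal (excess j)) = (\<Sum>j. \<integral>\<^sup>+k. ennreal (real (k - 1 - j)) \<partial>arrivals)"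
    unfolding excess_def
    by (intro suminf_cong nn_integral_eq_integral[symmetric] integrable_excess) simp
  also have "\<dots> = (\<integral>\<^sup>+k. (\<Sum>j. ennreal (real (k - 1 - j))) \<partial>arrivals)"
    by (rule nn_integral_suminf[symmetric]) simp
  also have "\<dots> = ennreal (rho lam B 2 / 2)"
    by (simp only: triangle nn_integral_arrivals_pairs[OF B_square_integrable])
  finally have sum: "(\<Sum>j. ennreal (excess j)) = ennreal (rho lam B 2 / 2)" .
  have "0 \<le> rho lam B 2"
    using lam_pos by (simp add: rho_def)
  moreover have summable: "summable excess"
    using sum by (intro summable_suminf_not_top) (simp_all add: excess_nonneg)
  moreover have "ennreal (suminf excess) = ennreal (rho lam B 2 / 2)"
    unfolding sum[symmetric] by (rule suminf_ennreal2[symmetric, OF excess_nonneg summable])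
  ultimately show ?thesis
    by (simp add: sums_iff suminf_nonneg excess_nonneg)
qed

text \<open>
  The equation \<open>mean_busy_rec\<close> below contains \<open>mean_busy m\<close> on both sides, with coefficient
  \<open>tail 0 = 1 - pi0\<close> on the right. Solving for it divides the other weights by \<open>pi0\<close>; at critical
  load they then add up to one.
\<close>

definition step_prob :: "nat \<Rightarrow> real" where
  "step_prob k = tail (Suc k) / pi0"

definition increment :: "nat \<Rightarrow> real" where
  "increment = renewal_seq step_prob (1 / pi0)"

text \<open>
  The mean number of messages served in a busy period, for \<open>m\<close> waiting places and \<open>m \<ge> 1\<close>
  (\<open>EP_eq\<close>). It is introduced through its increments, to which the renewal theorem applies.
\<close>

definition mean_busy :: "nat \<Rightarrow> real" where
  "mean_busy m = (\<Sum>j<m. increment j)"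

lemma B_mean_nonzero: "(\<integral>x. x \<partial>B) \<noteq> 0"
  using critical by (auto simp: rho_def)

lemma step_prob_0_pos: "0 < step_prob 0"
proof -
  have "pmf arrivals 2 \<le> tail 1"
    unfolding tail_def measure_pmf_single[symmetric] by (rule measure_pmf.finite_measure_mono) auto
  then show ?thesis
    using pmf_arrivals_2_pos[OF B_mean_nonzero] pmf_arrivals_0_pos by (simp add: step_prob_def)
qed

lemma renewal_increment: "renewal step_prob (\<lambda>k. excess k / pi0) increment"
proof
  have partial: "(\<Sum>k<n. step_prob k) = 1 - excess n / pi0" for n
    using pmf_arrivals_0_pos
    by (induction n) (simp_all add: excess_0 excess_Suc step_prob_def diff_divide_distrib)
  have "excess \<longlonglongrightarrow> 0"
    using excess_sums by (intro summable_LIMSEQ_zero) (rule sums_summable)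
  then have "(\<lambda>n. 1 - excess n / pi0) \<longlonglongrightarrow> 1 - 0 / pi0"
    using pmf_arrivals_0_pos by (intro tendsto_intros) simp_all
  then show "step_prob sums 1"
    by (simp add: sums_def partial)
  show "summable (\<lambda>k. excess k / pi0)"
    using excess_sums by (intro summable_divide) (rule sums_summable)
  show "0 < step_prob 0"
    by (rule step_prob_0_pos)
qed (use pmf_arrivals_0_pos in \<open>simp_all add: step_prob_def tail_nonneg excess_0 excess_Suc excess_nonneg
    diff_divide_distrib increment_def\<close>)

theorem increment_tendsto: "increment \<longlonglongrightarrow> 2 / rho lam B 2"
proof -
  interpret renewal step_prob "\<lambda>k. excess k / pi0" increment
    by (rule renewal_increment)
  have "(\<Sum>k. excess k / pi0) = rho lam B 2 / 2 / pi0"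
    using sums_divide[OF excess_sums] by (simp add: sums_iff)
  moreover have "increment 0 = 1 / pi0"
    by (simp add: increment_def)
  ultimately show ?thesis
    using renewal_theorem pmf_arrivals_0_pos by simp
qed

lemma mean_busy_rec:
  assumes "0 < m"
  shows "mean_busy m = 1 + (\<Sum>j<m. tail j * mean_busy (m - j))"
proof -
  obtain m' where m: "m = Suc m'" using assms by (cases m) auto
  have "pi0 * mean_busy m = pi0 * (1 / pi0 + (\<Sum>k<m'. step_prob k * mean_busy (m' - k)))"
    using sum_renewal_seq[of step_prob "1 / pi0" m']
    by (simp add: m mean_busy_def increment_def)
  also have "\<dots> = 1 + (\<Sum>k<m'. tail (Suc k) * mean_busy (m' - k))"
    using pmf_arrivals_0_pos by (simp add: distrib_left sum_distrib_left step_prob_def)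
  finally have "pi0 * mean_busy m = 1 + (\<Sum>k<m'. tail (Suc k) * mean_busy (m' - k))" .
  moreover have "(\<Sum>j<m. tail j * mean_busy (m - j)) =
      (1 - pi0) * mean_busy m + (\<Sum>k<m'. tail (Suc k) * mean_busy (m' - k))"
    unfolding m by (subst sum.lessThan_Suc_shift) (simp add: tail_0)
  ultimately show ?thesis by (simp add: algebra_simps)
qed

lemma increment_nonneg: "0 \<le> increment n"
proof (induction n rule: less_induct)
  case (less n)
  then show ?case
    unfolding increment_def
    by (cases n) (auto intro!: sum_nonneg mult_nonneg_nonneg simp: step_prob_def tail_nonneg)
qed

lemma mean_busy_nonneg: "0 \<le> mean_busy m"
  unfolding mean_busy_def by (simp add: sum_nonneg increment_nonneg)

text \<open>
  From \<open>i\<close> messages the system empties by descending through the levels \<open>i - 1, \<dots>, 0\<close> in turn. The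
  descent from \<open>l + 1\<close> to \<open>l\<close> serves as many messages as a busy period with \<open>n - l\<close> waiting places,
  since the \<open>l\<close> messages that remain keep as many places occupied. The sum \<open>g\<close> over the levels solves
  the first step equations because its increments satisfy \<open>mean_busy_rec\<close>.
\<close>

theorem SUP_mean_cost_processed:
  assumes "1 \<le> n"
  shows "(SUP m. mean_cost n (\<lambda>_ _. 1) m 1) = ennreal (mean_busy n)"
proof -
  define g where "g i = (\<Sum>l<i. mean_busy (n - l))" for i
  have g_nonneg: "0 \<le> g i" for i
    unfolding g_def by (simp add: sum_nonneg mean_busy_nonneg)
  have g_add: "g (i + j) = g i + (\<Sum>l<j. mean_busy (n - (i + l)))" for i j
    unfolding g_def by (induction j) simp_all
  have "(SUP m. mean_cost n (\<lambda>_ _. 1) m 1) = ennreal (g 1)"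
  proof (rule SUP_mean_cost)
    fix i assume i: "0 < i" "i \<le> n"
    define N where "N = n - i + 1"
    have split: "g (min (i - 1 + k) n) = g (i - 1) + (\<Sum>j<N. of_bool (j < k) * mean_busy (N - j))" for k
    proof -
      have "min (i - 1 + k) n = i - 1 + min k N"
        using i by (auto simp: N_def min_def)
      then have "g (min (i - 1 + k) n) = g (i - 1) + (\<Sum>j<min k N. mean_busy (n - (i - 1 + j)))"
        by (simp only: g_add)
      also have "(\<Sum>j<min k N. mean_busy (n - (i - 1 + j))) = (\<Sum>j<min k N. mean_busy (N - j))"
        using i by (intro sum.cong) (auto simp: N_def intro!: arg_cong[where f = mean_busy])
      also have "\<dots> = (\<Sum>j<N. of_bool (j < k) * mean_busy (N - j))"
        by (rule sum.mono_neutral_cong_left) auto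
      finally show ?thesis .
    qed
    have int: "integrable (measure_pmf arrivals) (\<lambda>k. 1 + g (min (i - 1 + k) n))"
      unfolding split using integrable_of_bool by (simp del: sum_of_bool_mult_eq)
    have "(\<integral>\<^sup>+k. (1 + ennreal (g (min (i - 1 + k) n))) \<partial>arrivals) =
        (\<integral>\<^sup>+k. ennreal (1 + g (min (i - 1 + k) n)) \<partial>arrivals)"
      using g_nonneg by (simp add: ennreal_plus)
    also have "\<dots> = ennreal (measure_pmf.expectation arrivals (\<lambda>k. 1 + g (min (i - 1 + k) n)))"
      by (rule nn_integral_eq_integral[OF int]) (simp add: g_nonneg)
    also have "measure_pmf.expectation arrivals (\<lambda>k. 1 + g (min (i - 1 + k) n)) =
        1 + (g (i - 1) + (\<Sum>j<N. tail j * mean_busy (N - j)))"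
      unfolding split using integrable_of_bool
      by (simp add: expectation_tail del: sum_of_bool_mult_eq)
    also have "\<dots> = g (i - 1) + mean_busy N"
      using mean_busy_rec[of N] by (simp add: N_def)
    also have "\<dots> = g i"
      using i by (cases i) (simp_all add: g_def N_def Suc_diff_Suc)
    finally show "ennreal (g i) = (\<integral>\<^sup>+k. (1 + ennreal (g (min (i - 1 + k) n))) \<partial>arrivals)" ..
  qed (use assms pmf_arrivals_0_pos g_nonneg in \<open>simp_all add: g_def[of 0]\<close>)
  then show ?thesis by (simp add: g_def)
qed

text \<open>
  With unit load the identity solves the equations: the excess over \<open>n\<close> is what is refused, and what
  is refused together with what remains has mean \<open>i - 1 + 1\<close>.
\<close>

theorem SUP_mean_cost_refused:
  assumes "1 \<le> n"
  shows "(SUP m. mean_cost n (\<lambda>i k. ennreal (real (i - 1 + k - n))) m 1) = 1"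
proof -
  have "(SUP m. mean_cost n (\<lambda>i k. ennreal (real (i - 1 + k - n))) m 1) = ennreal (real 1)"
  proof (rule SUP_mean_cost)
    fix i :: nat assume i: "0 < i"
    have int: "integrable (measure_pmf arrivals) (\<lambda>k. real (i - 1) + real k)"
      using integrable_arrivals by simp
    have "(\<integral>\<^sup>+k. (ennreal (real (i - 1 + k - n)) + ennreal (real (min (i - 1 + k) n))) \<partial>arrivals) =
        (\<integral>\<^sup>+k. ennreal (real (i - 1) + real k) \<partial>arrivals)"
      by (intro nn_integral_cong) (auto simp: min_def simp flip: ennreal_plus of_nat_add)
    also have "\<dots> = ennreal (measure_pmf.expectation arrivals (\<lambda>k. real (i - 1) + real k))"
      by (rule nn_integral_eq_integral[OF int]) simp
    also have "measure_pmf.expectation arrivals (\<lambda>k. real (i - 1) + real k) = real i"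
      using i integrable_arrivals by (simp add: mean_arrivals)
    finally show "ennreal (real i) = (\<integral>\<^sup>+k. (ennreal (real (i - 1 + k - n)) +
        ennreal (real (min (i - 1 + k) n))) \<partial>arrivals)" ..
  qed (use assms pmf_arrivals_0_pos in simp_all)
  then show ?thesis by simp
qed

end

section \<open>Sample paths of a busy period\<close>

text \<open>
  As long as the server has not been idle, the \<open>m\<close>-th service (counted from \<open>0\<close>) starts at this
  time.
\<close>

definition service_epoch :: "(nat \<Rightarrow> real) \<Rightarrow> (nat \<Rightarrow> real) \<Rightarrow> nat \<Rightarrow> real" where
  "service_epoch a s m = a 0 + (\<Sum>i<m. s i)"

text \<open>
  The number of messages that have arrived strictly before the start of service \<open>m\<close>. Message \<open>0\<close> is
  always included, hence the bound \<open>1 \<le> k\<close>, which matters if the first services take no time.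
\<close>

definition arrivals_until :: "(nat \<Rightarrow> real) \<Rightarrow> (nat \<Rightarrow> real) \<Rightarrow> nat \<Rightarrow> nat" where
  "arrivals_until a s m = (LEAST k. 1 \<le> k \<and> service_epoch a s m \<le> a k)"

text \<open>
  The number of messages in the system at the start of service \<open>m\<close>, including the one about to be
  served; meaningful up to its first zero.
\<close>

primrec queue :: "nat \<Rightarrow> (nat \<Rightarrow> real) \<Rightarrow> (nat \<Rightarrow> real) \<Rightarrow> nat \<Rightarrow> nat" where
  "queue n a s 0 = 1"
| "queue n a s (Suc m) =
     min (queue n a s m - 1 + (arrivals_until a s (Suc m) - arrivals_until a s m)) n"

definition num_acc :: "nat \<Rightarrow> (nat \<Rightarrow> real) \<Rightarrow> (nat \<Rightarrow> real) \<Rightarrow> nat \<Rightarrow> nat" where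
  "num_acc n a s k = card {i. i < k \<and> departure n a s i \<noteq> None}"

lemma num_acc_0 [simp]: "num_acc n a s 0 = 0"
  by (simp add: num_acc_def)

lemma num_acc_Suc:
  "num_acc n a s (Suc k) = num_acc n a s k + (if departure n a s k = None then 0 else 1)"
proof -
  have "{i. i < Suc k \<and> departure n a s i \<noteq> None} =
      (if departure n a s k = None then {} else {k}) \<union> {i. i < k \<and> departure n a s i \<noteq> None}"
    by (auto simp: less_Suc_eq)
  then show ?thesis
    by (simp add: num_acc_def)
qed

lemma num_acc_mono: "i \<le> k \<Longrightarrow> num_acc n a s i \<le> num_acc n a s k"
  unfolding num_acc_def by (intro card_mono) auto

lemma num_acc_less:
  assumes "i < k" and "departure n a s i \<noteq> None"
  shows "num_acc n a s i < num_acc n a s k"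
  using num_acc_mono[of "Suc i" k n a s] assms by (simp add: num_acc_Suc)

lemma num_acc_image:
  "num_acc n a s ` {i. i < k \<and> departure n a s i \<noteq> None} = {..<num_acc n a s k}"
proof (induction k)
  case (Suc k)
  have "{i. i < Suc k \<and> departure n a s i \<noteq> None} =
      (if departure n a s k = None then {} else {k}) \<union> {i. i < k \<and> departure n a s i \<noteq> None}"
    by (auto simp: less_Suc_eq)
  then have "num_acc n a s ` {i. i < Suc k \<and> departure n a s i \<noteq> None} =
      (if departure n a s k = None then {} else {num_acc n a s k}) \<union> {..<num_acc n a s k}"
    using Suc by (simp only: image_Un) simp
  also have "\<dots> = {..<num_acc n a s (Suc k)}"
    by (simp add: num_acc_Suc lessThan_Suc)
  finally show ?case .
qed simp

lemma inj_on_num_acc: "inj_on (num_acc n a s) {i. i < k \<and> departure n a s i \<noteq> None}"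
  by (rule inj_onI) (metis (mono_tags, lifting) mem_Collect_eq nat_neq_iff num_acc_less)

locale sample_path =
  fixes n :: nat and a s :: "nat \<Rightarrow> real"
  assumes a_strict: "strict_mono a" and s_nonneg: "\<And>m. 0 \<le> s m"
    and a_unbounded: "\<And>m. \<exists>k\<ge>1. service_epoch a s m \<le> a k"
begin

abbreviation "D \<equiv> service_epoch a s"
abbreviation "c \<equiv> arrivals_until a s"
abbreviation "q \<equiv> queue n a s"
abbreviation "dep \<equiv> departure n a s"
abbreviation "acc \<equiv> num_acc n a s"

lemma D_0: "D 0 = a 0" and D_Suc: "D (Suc m) = D m + s m"
  by (simp_all add: service_epoch_def)

lemma D_mono: "i \<le> j \<Longrightarrow> D i \<le> D j"
  unfolding service_epoch_def using s_nonneg by (auto intro: sum_mono2)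

lemma c_ge_1: "1 \<le> c m" and D_le_c: "D m \<le> a (c m)"
proof -
  have "1 \<le> c m \<and> D m \<le> a (c m)"
    unfolding arrivals_until_def by (rule LeastI_ex) (use a_unbounded in blast)
  then show "1 \<le> c m" "D m \<le> a (c m)" by simp_all
qed

lemma before_c: "1 \<le> k \<Longrightarrow> k < c m \<Longrightarrow> a k < D m"
  using not_less_Least[of k "\<lambda>k. 1 \<le> k \<and> D m \<le> a k"] by (auto simp: arrivals_until_def)

lemma from_c: "c m \<le> k \<Longrightarrow> D m \<le> a k"
  using D_le_c[of m] a_strict by (meson order_trans strict_mono_less_eq)

lemma c_le: "1 \<le> k \<Longrightarrow> D m \<le> a k \<Longrightarrow> c m \<le> k"
  unfolding arrivals_until_def by (rule Least_le) simp

lemma c_0: "c 0 = 1"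
  using c_le[of 1 0] c_ge_1[of 0] a_strict by (simp add: D_0 strict_mono_less_eq)

lemma c_mono: "i \<le> j \<Longrightarrow> c i \<le> c j"
  using c_le[of "c j" i] c_ge_1[of j] D_le_c[of j] D_mono[of i j] by simp

text \<open>
  The accepted messages before \<open>k\<close> depart in order at consecutive service epochs, that is, without
  idle time of the server.
\<close>

definition fifo :: "nat \<Rightarrow> bool" where
  "fifo k \<longleftrightarrow> (\<forall>i<k. dep i = None \<or> dep i = Some (D (Suc (acc i))))"

lemma fifoD: "fifo k \<Longrightarrow> i < k \<Longrightarrow> dep i \<noteq> None \<Longrightarrow> dep i = Some (D (Suc (acc i)))"
  by (auto simp: fifo_def)

lemma departure_first: "dep 0 = Some (D 1)"
  by (subst departure.simps) (simp add: service_epoch_def)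

text \<open>
  When message \<open>k\<close> arrives during service \<open>m\<close>, the accepted messages still present are those of
  ranks \<open>m, \<dots>, acc k - 1\<close>. The last of them departs at \<open>D (acc k)\<close>, when the service of \<open>k\<close> starts.
\<close>

lemma departure_step:
  assumes fifo: "fifo k" and m: "m < acc k" and ak: "D m \<le> a k" "a k < D (Suc m)"
  shows "dep k = (if acc k - m \<le> n then Some (D (Suc (acc k))) else None)"
proof -
  let ?A = "{i. i < k \<and> dep i \<noteq> None}"
  have "{i. i < k \<and> (\<exists>d. dep i = Some d \<and> a k < d)} = {i \<in> ?A. m \<le> acc i}"
  proof -
    have "a k < D (Suc (acc i)) \<longleftrightarrow> m \<le> acc i" for i
      using ak D_mono[of "Suc m" "Suc (acc i)"] D_mono[of "Suc (acc i)" m]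
      by (cases "m \<le> acc i") auto
    then show ?thesis
      using fifoD[OF fifo] by force
  qed
  moreover have "card {i \<in> ?A. m \<le> acc i} = acc k - m"
  proof -
    have "acc ` {i \<in> ?A. m \<le> acc i} = {..<acc k} \<inter> {m..}"
      unfolding num_acc_image[of n a s k, symmetric] by auto
    also have "\<dots> = {m..<acc k}"
      by auto
    finally have "card (acc ` {i \<in> ?A. m \<le> acc i}) = acc k - m"
      by simp
    then show ?thesis
      by (subst (asm) card_image) (auto intro: inj_on_subset[OF inj_on_num_acc[of n a s k]])
  qed
  moreover have "Max (insert (a k) {d. \<exists>i. i < k \<and> dep i = Some d}) = D (acc k)"
  proof -
    have "{d. \<exists>i. i < k \<and> dep i = Some d} = (\<lambda>i. D (Suc (acc i))) ` ?A"
      using fifoD[OF fifo] by (force simp: image_iff)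
    also have "\<dots> = (\<lambda>j. D (Suc j)) ` {..<acc k}"
      unfolding num_acc_image[of n a s k, symmetric] by (simp add: image_image)
    finally have eq: "{d. \<exists>i. i < k \<and> dep i = Some d} = (\<lambda>j. D (Suc j)) ` {..<acc k}" .
    show ?thesis
      unfolding eq
    proof (rule Max_eqI)
      show "D (acc k) \<in> insert (a k) ((\<lambda>j. D (Suc j)) ` {..<acc k})"
        using m by (auto intro!: rev_image_eqI[of "acc k - 1"])
      show "y \<le> D (acc k)" if "y \<in> insert (a k) ((\<lambda>j. D (Suc j)) ` {..<acc k})" for y
        using that ak m D_mono[of "Suc m" "acc k"] by (auto intro!: D_mono)
    qed simp
  qed
  ultimately show ?thesis
    by (subst departure.simps) (simp add: num_acc_def[symmetric] D_Suc del: not_None_eq)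
qed

text \<open>
  Arrivals during a service are accepted until \<open>n + 1\<close> messages are in the system.
\<close>

lemma during_service:
  assumes "fifo (c m)" and "acc (c m) = m + q m" and "0 < q m" and "q m \<le> Suc n"
    and "j \<le> c (Suc m) - c m"
  shows "fifo (c m + j) \<and> acc (c m + j) = m + min (q m + j) (Suc n)"
  using assms(5)
proof (induction j)
  case 0
  then show ?case using assms by simp
next
  case (Suc j)
  let ?k = "c m + j"
  from Suc have fifo: "fifo ?k" and acc: "acc ?k = m + min (q m + j) (Suc n)" by auto
  have k: "1 \<le> ?k" "?k < c (Suc m)"
    using Suc.prems c_ge_1[of m] by auto
  have "dep ?k = (if acc ?k - m \<le> n then Some (D (Suc (acc ?k))) else None)"
    using acc assms(3) from_c[of m ?k] before_c[OF k] by (intro departure_step[OF fifo]) auto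
  then show ?case
    using fifo acc by (auto simp: fifo_def less_Suc_eq num_acc_Suc min_def)
qed

lemma queue_le: "q m \<le> Suc n"
  by (cases m) auto

lemma acc_c:
  assumes "\<And>i. i < m \<Longrightarrow> 0 < q i"
  shows "fifo (c m) \<and> acc (c m) = m + q m"
  using assms
proof (induction m)
  case 0
  show ?case
    by (simp add: c_0 fifo_def num_acc_Suc departure_first)
next
  case (Suc m)
  then have "fifo (c m)" "acc (c m) = m + q m" "0 < q m" by auto
  from during_service[OF this queue_le order_refl]
  have "fifo (c (Suc m))" "acc (c (Suc m)) = m + min (q m + (c (Suc m) - c m)) (Suc n)"
    using c_mono[of m "Suc m"] by simp_all
  then show ?case
    using \<open>0 < q m\<close> by auto
qed

lemma service_interval:
  assumes "D 0 \<le> t" and "t < D P"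
  obtains m where "m < P" and "D m \<le> t" and "t < D (Suc m)"
proof -
  define m where "m = (LEAST j. t < D j)"
  have m: "t < D m" "m \<le> P"
    unfolding m_def using assms(2) by (auto intro: LeastI Least_le)
  then obtain m' where m': "m = Suc m'"
    using assms(1) by (cases m) auto
  have "\<not> t < D m'"
    using not_less_Least[of m' "\<lambda>j. t < D j"] m' by (simp add: m_def)
  then show ?thesis
    using m m' that[of m'] by simp
qed

context
  fixes P :: nat
  assumes P_zero: "q P = 0" and P_first: "\<And>m. m < P \<Longrightarrow> 0 < q m"
    and no_tie: "a (c P) \<noteq> D P"
begin

text \<open>
  Before \<open>D P\<close> some message is always in service. At \<open>D P\<close> all accepted messages have left, and the
  next arrival is later because ties are excluded.
\<close>

lemma busy_period_eq: "busy_period n a s = {..<c P}"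
proof (intro set_eqI iffI)
  fix k assume "k \<in> {..<c P}"
  show "k \<in> busy_period n a s"
    unfolding busy_period_def
  proof (intro CollectI allI impI)
    fix t assume t: "a 0 \<le> t \<and> t < a k"
    then have "1 \<le> k"
      by (cases k) auto
    then have "t < D P"
      using t before_c[of k P] \<open>k \<in> {..<c P}\<close> by simp
    with t obtain m where m: "m < P" "D m \<le> t" "t < D (Suc m)"
      using service_interval[of t P] by (metis D_0)
    have inv: "fifo (c m)" "acc (c m) = m + q m"
      using acc_c[of m] P_first m(1) by auto
    then have "m \<in> acc ` {i. i < c m \<and> dep i \<noteq> None}"
      unfolding num_acc_image using P_first[OF m(1)] by simp
    then obtain i where i: "i < c m" "dep i \<noteq> None" "acc i = m" by auto
    have "a i \<le> t"
      using before_c[of i m] i(1) m(2) t by (cases "i = 0") auto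
    then have "i \<in> in_system n a s t"
      using fifoD[OF inv(1) i(1,2)] i(3) m(3) by (simp add: in_system_def)
    then show "in_system n a s t \<noteq> {}" by blast
  qed
next
  fix k assume k: "k \<in> busy_period n a s"
  have inv: "fifo (c P)" "acc (c P) = P"
    using acc_c[of P] P_first P_zero by auto
  have "in_system n a s (D P) = {}"
  proof -
    have False if i: "a i \<le> D P" "dep i = Some d" "D P < d" for i d
    proof -
      have "i < c P"
        using from_c[of P i] i(1) no_tie a_strict D_le_c[of P]
        by (metis antisym linorder_not_less order_trans strict_mono_less_eq)
      then have "d = D (Suc (acc i))" and "acc i < P"
        using fifoD[OF inv(1), of i] i(2) num_acc_less[of i "c P" n a s] inv(2) by auto
      then show False
        using D_mono[of "Suc (acc i)" P] i(3) by simp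
    qed
    then show ?thesis by (auto simp: in_system_def)
  qed
  moreover have "a 0 \<le> D P"
    using D_mono[of 0 P] by (simp add: D_0)
  ultimately have "a k \<le> D P"
    using k by (force simp: busy_period_def)
  then show "k \<in> {..<c P}"
    using no_tie a_strict D_le_c[of P]
    by (metis antisym lessThan_iff linorder_not_less order_trans strict_mono_less_eq)
qed

lemma num_processed_eq: "num_processed n a s = P"
proof -
  have "num_processed n a s = acc (c P)"
    by (simp add: num_processed_def accepted_def busy_period_eq num_acc_def)
  then show ?thesis
    using acc_c[of P] P_first P_zero by simp
qed

lemma num_refused_eq: "num_refused n a s = c P - P"
proof -
  have "{k \<in> busy_period n a s. \<not> accepted n a s k} =
      {..<c P} - {k \<in> busy_period n a s. accepted n a s k}"
    by (auto simp: busy_period_eq)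
  moreover have "card \<dots> = card {..<c P} - card {k \<in> busy_period n a s. accepted n a s k}"
    by (rule card_Diff_subset) (auto simp: busy_period_eq intro: finite_subset[of _ "{..<c P}"])
  ultimately have "num_refused n a s = c P - num_processed n a s"
    by (simp add: num_refused_def num_processed_def)
  then show ?thesis
    by (simp add: num_processed_eq)
qed

end

end

text \<open>
  The gaps between the arrivals from number \<open>k\<close> on, the first one counted from time \<open>d\<close>.
\<close>

definition gaps :: "(nat \<Rightarrow> real) \<Rightarrow> real \<Rightarrow> nat \<Rightarrow> real stream" where
  "gaps a d k = to_stream (\<lambda>j. a (k + j) - (if j = 0 then d else a (k + j - 1)))"

lemma gaps_Stream: "gaps a d k = (a k - d) ## gaps a (a k) (Suc k)"
  unfolding gaps_def to_stream_nat_case[symmetric]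
  by (rule arg_cong[where f = to_stream]) (auto simp: fun_eq_iff split: nat.split)

lemma shd_gaps [simp]: "shd (gaps a d k) = a k - d"
  and stl_gaps [simp]: "stl (gaps a d k) = gaps a (a k) (Suc k)"
  by (subst gaps_Stream, simp)+

lemma gaps_initial: "gaps a (a 0) 1 = to_stream (\<lambda>k. a (Suc k) - a k)"
  unfolding gaps_def by (rule arg_cong[where f = to_stream]) auto

lemma count_is_gaps:
  "count_is j x (gaps a d k) \<longleftrightarrow> (\<forall>i<j. a (k + i) < d + x) \<and> d + x \<le> a (k + j)"
proof (induction j arbitrary: x d k)
  case (Suc j)
  show ?case
    by (auto simp: Suc All_less_Suc2 algebra_simps)
qed (auto simp: algebra_simps)

lemma residual_gaps: "residual j x (gaps a d k) = gaps a (d + x) (k + j)"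
proof (induction j arbitrary: x d k)
  case 0
  show ?case
    by (rule stream.expand) simp
next
  case (Suc j)
  then show ?case by (simp add: algebra_simps)
qed

context sample_path
begin

lemma count_is_service: "count_is k (s m) (gaps a (D m) (c m)) \<longleftrightarrow> c m + k = c (Suc m)"
proof
  assume "count_is k (s m) (gaps a (D m) (c m))"
  then have below: "\<And>i. i < k \<Longrightarrow> a (c m + i) < D (Suc m)" and above: "D (Suc m) \<le> a (c m + k)"
    by (auto simp: count_is_gaps D_Suc)
  have "c (Suc m) \<le> c m + k"
    using above c_ge_1[of m] by (intro c_le) simp_all
  moreover have "\<not> c (Suc m) < c m + k"
  proof
    assume "c (Suc m) < c m + k"
    then have "c (Suc m) - c m < k"
      using c_mono[of m "Suc m"] by linarith
    from below[OF this] show False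
      using c_mono[of m "Suc m"] D_le_c[of "Suc m"] by simp
  qed
  ultimately show "c m + k = c (Suc m)"
    by force
next
  assume "c m + k = c (Suc m)"
  then show "count_is k (s m) (gaps a (D m) (c m))"
    using D_le_c[of "Suc m"] before_c[of "c m + _" "Suc m"] c_ge_1[of m]
    by (auto simp: count_is_gaps D_Suc)
qed

text \<open>
  The stream recursion of \<open>cost\<close> follows the sample path: after \<open>m\<close> services the residual stream
  consists of the gaps from \<open>D m\<close> on. The hypothesis on \<open>P\<close> admits both the first zero of the queue
  length and any horizon before it.
\<close>

lemma cost_path:
  assumes "\<And>l. l < P \<Longrightarrow> 0 < q l" and "q P = 0 \<or> m + M \<le> P" and "m \<le> P"
  shows "cost n r M (q m) (gaps a (D m) (c m)) (sdrop m (to_stream s)) =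
    (\<Sum>l\<in>{m..<min (m + M) P}. r (q l) (c (Suc l) - c l))"
  using assms(2,3)
proof (induction M arbitrary: m)
  case (Suc M)
  show ?case
  proof (cases "m = P")
    case True
    then show ?thesis using Suc.prems by simp
  next
    case False
    then have m: "m < P" "0 < q m" using Suc.prems assms(1) by auto
    have shd: "to_stream s !! m = s m"
      by (simp add: to_stream_def)
    let ?N = "c (Suc m) - c m"
    let ?rest = "\<lambda>k. cost n r M (min (q m - 1 + k) n) (residual k (s m) (gaps a (D m) (c m)))
      (sdrop (Suc m) (to_stream s))"
    have N: "c m + k = c (Suc m) \<longleftrightarrow> k = ?N" for k
      using c_mono[of m "Suc m"] by auto
    have "cost n r (Suc M) (q m) (gaps a (D m) (c m)) (sdrop m (to_stream s)) =
        (\<Sum>k. if k = ?N then r (q m) k + ?rest k else 0)"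
      using m(2) by (simp add: shd count_is_service N cong: if_cong flip: sdrop_stl)
    also have "\<dots> = r (q m) ?N + ?rest ?N"
      by (subst suminf_finite[of "{?N}"]) simp_all
    also have "?rest ?N = cost n r M (q (Suc m)) (gaps a (D (Suc m)) (c (Suc m))) (sdrop (Suc m) (to_stream s))"
      using c_mono[of m "Suc m"] by (simp add: residual_gaps D_Suc)
    also have "\<dots> = (\<Sum>l\<in>{Suc m..<min (Suc m + M) P}. r (q l) (c (Suc l) - c l))"
      by (rule Suc.IH) (use Suc.prems m in auto)
    also have "r (q m) ?N + \<dots> = (\<Sum>l\<in>{m..<min (m + Suc M) P}. r (q l) (c (Suc l) - c l))"
      using m by (subst (2) sum.atLeast_Suc_lessThan) auto
    finally show ?thesis .
  qed
qed simp

lemma cost_path_initial: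
  assumes "\<And>l. l < P \<Longrightarrow> 0 < q l" and "q P = 0 \<or> M \<le> P"
  shows "cost n r M 1 (to_stream (\<lambda>k. a (Suc k) - a k)) (to_stream s) =
    (\<Sum>l<min M P. r (q l) (c (Suc l) - c l))"
  using cost_path[of P 0 M r] assms
  by (simp add: c_0 D_0 gaps_initial[unfolded One_nat_def] lessThan_atLeast0)

text \<open>
  Every message that has arrived by the start of service \<open>P\<close> has been refused, is present or has
  been served.
\<close>

lemma refused_telescope:
  assumes "\<And>l. l < P \<Longrightarrow> 0 < q l"
  shows "(\<Sum>l<P. q l - 1 + (c (Suc l) - c l) - n) + q P + P = c P"
  using assms
proof (induction P)
  case (Suc P)
  then have "(\<Sum>l<P. q l - 1 + (c (Suc l) - c l) - n) + q P + P = c P" and "0 < q P"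
    by auto
  then show ?case
    using c_mono[of P "Suc P"] by (simp add: min_def)
qed (simp add: c_0)

text \<open>
  A busy period that never ends would have infinitely many services.
\<close>

lemma queue_empties:
  assumes "(SUP M. cost n (\<lambda>_ _. 1) M 1 (to_stream (\<lambda>k. a (Suc k) - a k)) (to_stream s)) \<noteq> \<infinity>"
  shows "\<exists>P. q P = 0"
proof (rule ccontr)
  assume "\<not> (\<exists>P. q P = 0)"
  then have pos: "\<And>l. 0 < q l" by simp
  have "cost n (\<lambda>_ _. 1) M 1 (to_stream (\<lambda>k. a (Suc k) - a k)) (to_stream s) = of_nat M" for M
    using cost_path_initial[of M M "\<lambda>_ _. 1"] pos by simp
  then show False
    using assms ennreal_SUP_of_nat_eq_top by simp
qed

theorem SUP_cost_path:
  assumes "\<exists>P. q P = 0" and no_tie: "\<And>m. a (c m) \<noteq> D m"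
  shows "(SUP M. cost n (\<lambda>_ _. 1) M 1 (to_stream (\<lambda>k. a (Suc k) - a k)) (to_stream s)) =
      ennreal (real (num_processed n a s))" (is ?processed)
    and "(SUP M. cost n (\<lambda>i k. ennreal (real (i - 1 + k - n))) M 1
        (to_stream (\<lambda>k. a (Suc k) - a k)) (to_stream s)) =
      ennreal (real (num_refused n a s))" (is ?refused)
proof -
  define P where "P = (LEAST P. q P = 0)"
  have P: "q P = 0" "\<And>l. l < P \<Longrightarrow> 0 < q l"
    unfolding P_def using assms(1) by (auto intro: LeastI dest: not_less_Least)
  have SUP: "(SUP M. cost n r M 1 (to_stream (\<lambda>k. a (Suc k) - a k)) (to_stream s)) =
      (\<Sum>l<P. r (q l) (c (Suc l) - c l))" for r
  proof -
    have "cost n r M 1 (to_stream (\<lambda>k. a (Suc k) - a k)) (to_stream s) =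
        (\<Sum>l<min M P. r (q l) (c (Suc l) - c l))" for M
      by (rule cost_path_initial) (use P in auto)
    moreover have "(SUP M. \<Sum>l<min M P. r (q l) (c (Suc l) - c l)) =
        (\<Sum>l<P. r (q l) (c (Suc l) - c l))"
    proof (rule antisym)
      show "(SUP M. \<Sum>l<min M P. r (q l) (c (Suc l) - c l)) \<le> (\<Sum>l<P. r (q l) (c (Suc l) - c l))"
        by (intro SUP_least sum_mono2) auto
      show "(\<Sum>l<P. r (q l) (c (Suc l) - c l)) \<le> (SUP M. \<Sum>l<min M P. r (q l) (c (Suc l) - c l))"
        by (intro SUP_upper2[of P]) simp_all
    qed
    ultimately show ?thesis by simp
  qed
  show ?processed
    unfolding SUP using num_processed_eq[OF P no_tie] by (simp add: ennreal_of_nat_eq_real_of_nat)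
  have "(\<Sum>l<P. q l - 1 + (c (Suc l) - c l) - n) = num_refused n a s"
    using refused_telescope[of P] P num_refused_eq[OF P no_tie] by simp
  then show ?refused
    unfolding SUP by (subst sum_ennreal) (simp_all flip: of_nat_sum)
qed

end

section \<open>Measurability of the counts\<close>

text \<open>
  Refused messages and messages with an empty sojourn interval are discarded by giving them the
  value \<open>\<infinity>\<close>, which does not affect a lower limit unless only finitely many messages remain.
\<close>

definition departure_limit :: "nat \<Rightarrow> (nat \<Rightarrow> real) \<Rightarrow> (nat \<Rightarrow> real) \<Rightarrow> ereal" where
  "departure_limit n a s = liminf (\<lambda>i. case departure n a s i of
     None \<Rightarrow> \<infinity> | Some d \<Rightarrow> if a i < d then ereal d else \<infinity>)"

text \<open>
  If the departures up to time \<open>t\<close> accumulate at their supremum, then the supremum is the limit of all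
  departures: of \<open>n + 1\<close> departures beyond some \<open>c\<close>, at least one must have taken place before any
  later message is accepted, so later sojourns lie beyond \<open>c\<close>. The argument covers all sample paths,
  those of the null set included on which arrivals are out of order or service times negative.
\<close>

lemma departure_limit_eq:
  fixes n a s t
  defines "E \<equiv> {d. \<exists>i. departure n a s i = Some d \<and> a i < d \<and> d \<le> t}"
  assumes "E \<noteq> {}" and not_attained: "Sup E \<notin> E"
  shows "departure_limit n a s = ereal (Sup E)"
proof -
  define g where "g i = (case departure n a s i of
     None \<Rightarrow> \<infinity> | Some d \<Rightarrow> if a i < d then ereal d else \<infinity>)" for i
  define I where "I c = {i. \<exists>d. departure n a s i = Some d \<and> a i < d \<and> d \<le> t \<and> c < d}" for c
  have bdd: "bdd_above E"
    unfolding E_def by (rule bdd_aboveI[of _ t]) auto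
  (* A finite set of departures beyond c would attain the supremum. *)
  have infinite: "infinite (I c)" if c: "c < Sup E" for c
  proof
    assume fin: "finite (I c)"
    define E' where "E' = {d \<in> E. c < d}"
    have "E' \<subseteq> (\<lambda>i. the (departure n a s i)) ` I c"
      unfolding E'_def E_def I_def by force
    then have "finite E'"
      using fin finite_surj by blast
    moreover have "E' \<noteq> {}"
      using c \<open>E \<noteq> {}\<close> bdd by (auto simp: E'_def less_cSup_iff)
    ultimately have max: "Max E' \<in> E'" "\<And>d. d \<in> E' \<Longrightarrow> d \<le> Max E'"
      by simp_all
    have "Sup E = Max E'"
    proof (rule cSup_eq_maximum)
      show "Max E' \<in> E" using max(1) by (simp add: E'_def)
      show "d \<le> Max E'" if "d \<in> E" for d
        using max that by (cases "c < d") (force simp: E'_def)+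
    qed
    then show False
      using max(1) not_attained by (simp add: E'_def)
  qed
  have "liminf g \<le> ereal (Sup E)"
  proof (rule ccontr)
    assume "\<not> liminf g \<le> ereal (Sup E)"
    then have "\<forall>\<^sub>F i in sequentially. ereal (Sup E) < g i"
      by (intro less_LiminfD) simp
    then obtain N where N: "\<And>i. N \<le> i \<Longrightarrow> ereal (Sup E) < g i"
      by (auto simp: eventually_sequentially)
    obtain i where "N \<le> i" "i \<in> I (Sup E - 1)"
      using infinite[of "Sup E - 1"] by (auto simp: infinite_nat_iff_unbounded_le)
    moreover from this obtain d where "departure n a s i = Some d" "a i < d" "d \<in> E"
      by (auto simp: I_def E_def)
    ultimately show False
      using N[of i] cSup_upper[OF _ bdd, of d] by (simp add: g_def)
  qed
  moreover have "ereal (Sup E) \<le> liminf g"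
    unfolding le_Liminf_iff
  proof (intro allI impI)
    fix y assume "y < ereal (Sup E)"
    then obtain c where c: "y < ereal c" "c < Sup E"
      using ereal_dense2 by force
    (* If a later message j left by c, all n + 1 members of J would still be present at its
       arrival, and j would have been refused. *)
    obtain J where J: "finite J" "card J = Suc n" "J \<subseteq> I c"
      using infinite_arbitrarily_large[OF infinite[OF c(2)]] by blast
    have "y < g j" if j: "Suc (Max J) \<le> j" for j
    proof (rule ccontr)
      assume "\<not> y < g j"
      then obtain d where d: "departure n a s j = Some d" "a j < d" "ereal d \<le> y"
        using c(1) by (cases "departure n a s j") (auto simp: g_def not_less split: if_splits)
      then have "d < c"
        using le_less_trans[OF d(3) c(1)] by simp
      have "J \<subseteq> {i. i < j \<and> (\<exists>d. departure n a s i = Some d \<and> a j < d)}"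
      proof
        fix i assume "i \<in> J"
        then obtain e where "departure n a s i = Some e" "c < e"
          using J(3) by (auto simp: I_def)
        moreover have "i < j"
          using Max_ge[OF J(1) \<open>i \<in> J\<close>] j by simp
        ultimately show "i \<in> {i. i < j \<and> (\<exists>d. departure n a s i = Some d \<and> a j < d)}"
          using d(2) \<open>d < c\<close> by auto
      qed
      then have "Suc n \<le> card {i. i < j \<and> (\<exists>d. departure n a s i = Some d \<and> a j < d)}"
        unfolding J(2)[symmetric] by (intro card_mono) auto
      then have "departure n a s j = None"
        by (subst departure.simps) simp
      then show False using d(1) by simp
    qed
    then show "\<forall>\<^sub>F j in sequentially. y < g j"
      unfolding eventually_sequentially by blast
  qed
  ultimately show ?thesis
    unfolding departure_limit_def g_def[symmetric] by (rule antisym)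
qed

text \<open>
  Whether the system is never empty between two arrivals need only be tested at countably many times.
  A time at which it is empty can be moved back to the supremum of the preceding departures. This
  supremum is itself a departure or, by \<open>departure_limit_eq\<close>, the one possible accumulation
  point.
\<close>

lemma busy_period_iff:
  "k \<in> busy_period n a s \<longleftrightarrow>
    (\<forall>x \<in> {a 0, real_of_ereal (departure_limit n a s)} \<union> {d. \<exists>i. departure n a s i = Some d}.
      a 0 \<le> x \<and> x < a k \<longrightarrow> in_system n a s x \<noteq> {})"
  (is "_ \<longleftrightarrow> (\<forall>x\<in>?X. ?ok x)")
proof
  assume ok: "\<forall>x\<in>?X. ?ok x"
  show "k \<in> busy_period n a s"
    unfolding busy_period_def
  proof (intro CollectI allI impI notI)
    fix t assume t: "a 0 \<le> t \<and> t < a k" and empty: "in_system n a s t = {}"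
    define E where "E = {d. \<exists>i. departure n a s i = Some d \<and> a i < d \<and> d \<le> t}"
    have bdd: "bdd_above E"
      unfolding E_def by (rule bdd_aboveI[of _ t]) auto
    have empty': "in_system n a s x = {}" if "x \<le> t" "\<And>d. d \<in> E \<Longrightarrow> d \<le> x" for x
      using that empty by (force simp: in_system_def E_def)
    show False
    proof (cases "\<forall>d\<in>E. d \<le> a 0")
      case True
      then show False
        using ok t empty'[of "a 0"] by auto
    next
      case False
      then obtain e where e: "e \<in> E" "a 0 < e" by auto
      have "Sup E \<le> t"
        using e by (intro cSup_least) (auto simp: E_def)
      moreover have "a 0 \<le> Sup E"
        using cSup_upper[OF e(1) bdd] e(2) by simp
      moreover have "in_system n a s (Sup E) = {}"
        using \<open>Sup E \<le> t\<close> cSup_upper[OF _ bdd] by (intro empty') auto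
      moreover have "Sup E \<in> ?X"
      proof (cases "Sup E \<in> E")
        case True
        then show ?thesis by (auto simp: E_def)
      next
        case False
        then have "departure_limit n a s = ereal (Sup E)"
          unfolding E_def using e(1) by (intro departure_limit_eq) (auto simp: E_def)
        then show ?thesis by simp
      qed
      ultimately show False
        using ok t by force
    qed
  qed
qed (auto simp: busy_period_def)

lemma departure_measurable:
  fixes a s :: "nat \<Rightarrow> 'w \<Rightarrow> real"
  assumes [measurable]: "\<And>k. a k \<in> borel_measurable M" "\<And>m. s m \<in> borel_measurable M"
  shows "Measurable.pred M (\<lambda>\<omega>. departure n (\<lambda>k. a k \<omega>) (\<lambda>m. s m \<omega>) k = None) \<and>
    (\<lambda>\<omega>. the (departure n (\<lambda>k. a k \<omega>) (\<lambda>m. s m \<omega>) k)) \<in> borel_measurable M"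
proof (induction k rule: less_induct)
  case (less k)
  note not_None_eq [simp del]
  let ?dep = "\<lambda>\<omega>. departure n (\<lambda>k. a k \<omega>) (\<lambda>m. s m \<omega>)"
  have [measurable]: "Measurable.pred M (\<lambda>\<omega>. ?dep \<omega> i = None)"
    "(\<lambda>\<omega>. the (?dep \<omega> i)) \<in> borel_measurable M" if "i < k" for i
    using less that by auto
  have ex: "(\<exists>d. ?dep \<omega> i = Some d \<and> Q d) \<longleftrightarrow> ?dep \<omega> i \<noteq> None \<and> Q (the (?dep \<omega> i))" for i \<omega> Q
    by auto
  have [measurable]: "Measurable.pred M (\<lambda>\<omega>. i < k \<and> ?dep \<omega> i \<noteq> None)" for i
    by (cases "i < k") simp_all
  have [measurable]: "Measurable.pred M
      (\<lambda>\<omega>. i < k \<and> ?dep \<omega> i \<noteq> None \<and> a k \<omega> < the (?dep \<omega> i))" for i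
    by (cases "i < k") simp_all
  define present where "present \<omega> = card {i. i < k \<and> (\<exists>d. ?dep \<omega> i = Some d \<and> a k \<omega> < d)}" for \<omega>
  define previous where "previous \<omega> = card {i. i < k \<and> ?dep \<omega> i \<noteq> None}" for \<omega>
  define start where "start \<omega> = Max (insert (a k \<omega>) {d. \<exists>i. i < k \<and> ?dep \<omega> i = Some d})" for \<omega>
  have dep: "?dep \<omega> k =
      (if present \<omega> \<le> n then Some (start \<omega> + s (previous \<omega>) \<omega>) else None)" for \<omega>
    unfolding present_def previous_def start_def by (subst departure.simps) simp
  have [measurable]: "present \<in> measurable M (count_space UNIV)"
    unfolding present_def ex by measurable
  have [measurable]: "previous \<in> measurable M (count_space UNIV)"
    unfolding previous_def by (rule measurable_card) simp
  have "start \<omega> \<le> x \<longleftrightarrow> a k \<omega> \<le> x \<and> (\<forall>i<k. ?dep \<omega> i \<noteq> None \<longrightarrow> the (?dep \<omega> i) \<le> x)" for \<omega> x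
  proof -
    have "{d. \<exists>i. i < k \<and> ?dep \<omega> i = Some d} =
        (\<lambda>i. the (?dep \<omega> i)) ` {i. i < k \<and> ?dep \<omega> i \<noteq> None}"
      by force
    then show ?thesis
      unfolding start_def by auto
  qed
  moreover have "Measurable.pred M (\<lambda>\<omega>. i < k \<longrightarrow> ?dep \<omega> i \<noteq> None \<longrightarrow> the (?dep \<omega> i) \<le> x)" for i x
    by (cases "i < k") simp_all
  ultimately have [measurable]: "start \<in> borel_measurable M"
    unfolding borel_measurable_iff_le by simp
  have [measurable]: "(\<lambda>\<omega>. s (previous \<omega>) \<omega>) \<in> borel_measurable M"
    by (rule measurable_compose_countable) simp_all
  have "the (?dep \<omega> k) = (if present \<omega> \<le> n then start \<omega> + s (previous \<omega>) \<omega> else the None)" for \<omega>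
    by (simp add: dep)
  then have "(\<lambda>\<omega>. the (?dep \<omega> k)) \<in> borel_measurable M"
    by simp
  moreover have "Measurable.pred M (\<lambda>\<omega>. ?dep \<omega> k = None)"
    by (simp add: dep)
  ultimately show ?case by blast
qed

lemma busy_period_measurable:
  fixes a s :: "nat \<Rightarrow> 'w \<Rightarrow> real"
  assumes [measurable]: "\<And>k. a k \<in> borel_measurable M" "\<And>m. s m \<in> borel_measurable M"
  shows "Measurable.pred M (\<lambda>\<omega>. k \<in> busy_period n (\<lambda>k. a k \<omega>) (\<lambda>m. s m \<omega>))"
proof -
  note not_None_eq [simp del]
  let ?dep = "\<lambda>\<omega>. departure n (\<lambda>k. a k \<omega>) (\<lambda>m. s m \<omega>)"
  let ?lim = "\<lambda>\<omega>. departure_limit n (\<lambda>k. a k \<omega>) (\<lambda>m. s m \<omega>)"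
  have [measurable]: "Measurable.pred M (\<lambda>\<omega>. ?dep \<omega> i = None)"
    "(\<lambda>\<omega>. the (?dep \<omega> i)) \<in> borel_measurable M" for i
    using departure_measurable[of a M s n i] by simp_all
  have in_sys: "in_system n (\<lambda>k. a k \<omega>) (\<lambda>m. s m \<omega>) x \<noteq> {} \<longleftrightarrow>
      (\<exists>i. a i \<omega> \<le> x \<and> ?dep \<omega> i \<noteq> None \<and> x < the (?dep \<omega> i))" for x \<omega>
    by (force simp: in_system_def)
  have "?lim \<omega> = liminf (\<lambda>i. if ?dep \<omega> i \<noteq> None \<and> a i \<omega> < the (?dep \<omega> i)
      then ereal (the (?dep \<omega> i)) else \<infinity>)" for \<omega>
    unfolding departure_limit_def
    by (rule arg_cong[where f = liminf]) (auto split: option.split)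
  then have [measurable]: "?lim \<in> borel_measurable M"
    by (simp only:) measurable
  have "k \<in> busy_period n (\<lambda>k. a k \<omega>) (\<lambda>m. s m \<omega>) \<longleftrightarrow>
      (a 0 \<omega> < a k \<omega> \<longrightarrow> in_system n (\<lambda>k. a k \<omega>) (\<lambda>m. s m \<omega>) (a 0 \<omega>) \<noteq> {}) \<and>
      (a 0 \<omega> \<le> real_of_ereal (?lim \<omega>) \<and> real_of_ereal (?lim \<omega>) < a k \<omega> \<longrightarrow>
        in_system n (\<lambda>k. a k \<omega>) (\<lambda>m. s m \<omega>) (real_of_ereal (?lim \<omega>)) \<noteq> {}) \<and>
      (\<forall>i. ?dep \<omega> i \<noteq> None \<longrightarrow> a 0 \<omega> \<le> the (?dep \<omega> i) \<and> the (?dep \<omega> i) < a k \<omega> \<longrightarrow>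
        in_system n (\<lambda>k. a k \<omega>) (\<lambda>m. s m \<omega>) (the (?dep \<omega> i)) \<noteq> {})" for \<omega>
    unfolding busy_period_iff by force
  then show ?thesis
    unfolding in_sys by simp
qed

lemma
  fixes a s :: "nat \<Rightarrow> 'w \<Rightarrow> real"
  assumes a: "\<And>k. a k \<in> borel_measurable M" and s: "\<And>m. s m \<in> borel_measurable M"
  shows num_processed_measurable:
      "(\<lambda>\<omega>. num_processed n (\<lambda>k. a k \<omega>) (\<lambda>m. s m \<omega>)) \<in> measurable M (count_space UNIV)"
    and num_refused_measurable:
      "(\<lambda>\<omega>. num_refused n (\<lambda>k. a k \<omega>) (\<lambda>m. s m \<omega>)) \<in> measurable M (count_space UNIV)"
proof -
  note not_None_eq [simp del]
  have [measurable]: "Measurable.pred M (\<lambda>\<omega>. k \<in> busy_period n (\<lambda>k. a k \<omega>) (\<lambda>m. s m \<omega>))"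
    "Measurable.pred M (\<lambda>\<omega>. accepted n (\<lambda>k. a k \<omega>) (\<lambda>m. s m \<omega>) k)" for k
    using busy_period_measurable[of a M s k n] departure_measurable[of a M s n k] a s
    by (simp_all add: accepted_def pred_intros_logic)
  show "(\<lambda>\<omega>. num_processed n (\<lambda>k. a k \<omega>) (\<lambda>m. s m \<omega>)) \<in> measurable M (count_space UNIV)"
    "(\<lambda>\<omega>. num_refused n (\<lambda>k. a k \<omega>) (\<lambda>m. s m \<omega>)) \<in> measurable M (count_space UNIV)"
    unfolding num_processed_def num_refused_def by measurable
qed

section \<open>The random input as a pair of streams\<close>

context MGI1_input
begin

sublocale poisson_input lam B
  by (rule poisson_input.intro[OF lam_pos B_law B_nonneg])

abbreviation "input \<equiv> case_sum T S"

definition arrival_gaps :: "'w \<Rightarrow> real stream" where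
  "arrival_gaps \<omega> = to_stream (\<lambda>k. T (Suc k) \<omega>)"

definition service_times :: "'w \<Rightarrow> real stream" where
  "service_times \<omega> = to_stream (\<lambda>m. S m \<omega>)"

lemma input_measurable: "input i \<in> borel_measurable M"
  using independent by (auto simp: indep_vars_def2)

lemma T_measurable [measurable]: "T k \<in> borel_measurable M"
  and S_measurable [measurable]: "S m \<in> borel_measurable M"
  using input_measurable[of "Inl k"] input_measurable[of "Inr m"] by simp_all

lemma T_law: "distr M borel (T k) = exp_law lam"
proof -
  have "distr M borel (T k) = distr M lborel (T k)"
    by (rule distr_cong) simp_all
  then show ?thesis
    using interarrival[of k] by (simp add: distributed_def exp_law_def)
qed

text \<open>
  Any injective selection of identically distributed inputs forms an i.i.d. stream.
\<close>

lemma stream_law: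
  fixes f :: "nat \<Rightarrow> nat + nat"
  assumes inj: "inj f" and N: "\<And>n. distr M borel (input (f n)) = N"
  shows "distr M (stream_space borel) (\<lambda>\<omega>. to_stream (\<lambda>n. input (f n) \<omega>)) = stream_space N"
proof -
  let ?L = "\<lambda>i. distr M borel (input i)"
  let ?P = "\<Pi>\<^sub>M i\<in>(UNIV :: (nat + nat) set). (borel :: real measure)"
  have [measurable]: "(\<lambda>\<omega>. \<lambda>i\<in>UNIV. input i \<omega>) \<in> measurable M ?P"
    by (intro measurable_restrict input_measurable)
  have [measurable]: "(\<lambda>x. to_stream (\<lambda>n. x (f n))) \<in> measurable ?P (stream_space borel)"
    by (intro measurable_compose[OF _ measurable_to_stream] measurable_abs_UNIV
        measurable_component_singleton) simp
  have joint: "distr M ?P (\<lambda>\<omega>. \<lambda>i\<in>UNIV. input i \<omega>) = (\<Pi>\<^sub>M i\<in>UNIV. ?L i)"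
    using indep_vars_iff_distr_eq_PiM[where I = UNIV and M' = "\<lambda>_. borel" and X = input]
      independent input_measurable by simp
  have sets_N: "sets N = sets borel"
    using N[of 0] by (metis sets_distr)
  have "distr M (stream_space borel) (\<lambda>\<omega>. to_stream (\<lambda>n. input (f n) \<omega>)) =
      distr (distr M ?P (\<lambda>\<omega>. \<lambda>i\<in>UNIV. input i \<omega>)) (stream_space borel) (\<lambda>x. to_stream (\<lambda>n. x (f n)))"
    by (subst distr_distr) (simp_all add: comp_def)
  also have "\<dots> = distr (\<Pi>\<^sub>M i\<in>UNIV. ?L i) (stream_space borel) (\<lambda>x. to_stream (\<lambda>n. x (f n)))"
    by (simp only: joint)
  also have "\<dots> = distr (distr (\<Pi>\<^sub>M i\<in>UNIV. ?L i) (\<Pi>\<^sub>M n\<in>UNIV. ?L (f n)) (\<lambda>x. \<lambda>n\<in>UNIV. x (f n)))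
      (stream_space borel) to_stream"
  proof (subst distr_distr)
    show "(\<lambda>x. \<lambda>n\<in>UNIV. x (f n)) \<in> measurable (\<Pi>\<^sub>M i\<in>UNIV. ?L i) (\<Pi>\<^sub>M n\<in>UNIV. ?L (f n))"
      by (intro measurable_restrict measurable_component_singleton) simp
    have "to_stream \<in> measurable (\<Pi>\<^sub>M n\<in>UNIV. N) (stream_space N)"
      by (rule measurable_to_stream)
    then show "to_stream \<in> measurable (\<Pi>\<^sub>M n\<in>UNIV. ?L (f n)) (stream_space borel)"
      unfolding N using sets_stream_space_cong[OF sets_N] by (simp cong: measurable_cong_sets)
  qed (simp add: comp_def restrict_UNIV)
  also have "distr (\<Pi>\<^sub>M i\<in>UNIV. ?L i) (\<Pi>\<^sub>M n\<in>UNIV. ?L (f n)) (\<lambda>x. \<lambda>n\<in>UNIV. x (f n)) =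
      (\<Pi>\<^sub>M n\<in>UNIV. ?L (f n))"
    by (rule distr_PiM_reindex) (use inj input_measurable in \<open>auto intro: prob_space_distr\<close>)
  also have "\<dots> = (\<Pi>\<^sub>M n\<in>UNIV. N)"
    by (simp only: N)
  also have "distr \<dots> (stream_space borel) to_stream = stream_space N"
    by (subst stream_space_eq_distr) (rule distr_cong, simp_all add: sets_stream_space_cong[OF sets_N])
  finally show ?thesis .
qed

lemma service_times_law: "distr M (stream_space borel) service_times = stream_space B"
  using stream_law[of Inr B] by (simp add: service service_times_def[abs_def])

lemma arrival_gaps_law: "distr M (stream_space borel) arrival_gaps = stream_space (exp_law lam)"
  using stream_law[of "\<lambda>n. Inl (Suc n)" "exp_law lam"]
  by (simp add: T_law arrival_gaps_def[abs_def] inj_def)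

lemma streams_independent:
  "indep_var (stream_space borel) service_times (stream_space borel) arrival_gaps"
proof -
  let ?A = "range Inr :: (nat + nat) set" and ?B = "range (\<lambda>n. Inl (Suc n)) :: (nat + nat) set"
  have "indep_var (stream_space borel)
      ((\<lambda>x. to_stream (\<lambda>n. x (Inr n))) \<circ> (\<lambda>\<omega>. restrict (\<lambda>i. input i \<omega>) ?A)) (stream_space borel)
      ((\<lambda>x. to_stream (\<lambda>n. x (Inl (Suc n)))) \<circ> (\<lambda>\<omega>. restrict (\<lambda>i. input i \<omega>) ?B))"
    by (intro indep_var_compose[OF indep_var_restrict[OF independent]]
        measurable_compose[OF _ measurable_to_stream] measurable_abs_UNIV
        measurable_component_singleton) auto
  then show ?thesis
    by (simp add: comp_def service_times_def[abs_def] arrival_gaps_def[abs_def])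
qed

lemma streams_measurable [measurable]:
  "service_times \<in> measurable M (stream_space borel)" "arrival_gaps \<in> measurable M (stream_space borel)"
  using streams_independent by (auto simp: indep_var_distribution_eq)

lemma streams_joint_law:
  "distr M (stream_space borel \<Otimes>\<^sub>M stream_space borel) (\<lambda>\<omega>. (service_times \<omega>, arrival_gaps \<omega>)) =
    stream_space B \<Otimes>\<^sub>M stream_space (exp_law lam)"
  using streams_independent
  by (simp add: indep_var_distribution_eq service_times_law arrival_gaps_law)

sublocale streams: pair_sigma_finite "stream_space B" "stream_space (exp_law lam)"
  by unfold_locales

lemma nn_integral_cost:
  "(\<integral>\<^sup>+\<omega>. cost n r m i (arrival_gaps \<omega>) (service_times \<omega>) \<partial>M) = mean_cost n r m i"
proof -
  have "(\<integral>\<^sup>+\<omega>. cost n r m i (arrival_gaps \<omega>) (service_times \<omega>) \<partial>M) =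
      (\<integral>\<^sup>+p. cost n r m i (snd p) (fst p)
        \<partial>distr M (stream_space borel \<Otimes>\<^sub>M stream_space borel) (\<lambda>\<omega>. (service_times \<omega>, arrival_gaps \<omega>)))"
    by (subst nn_integral_distr) simp_all
  also have "\<dots> = mean_cost n r m i"
    unfolding streams_joint_law mean_cost_def by (subst \<tau>.nn_integral_fst[symmetric]) simp_all
  finally show ?thesis .
qed

lemma nn_integral_SUP_cost:
  "(\<integral>\<^sup>+\<omega>. (SUP m. cost n r m i (arrival_gaps \<omega>) (service_times \<omega>)) \<partial>M) = (SUP m. mean_cost n r m i)"
  by (subst nn_integral_monotone_convergence_SUP)
    (auto simp: nn_integral_cost incseq_Suc_iff le_fun_def cost_mono simp del: cost.simps)

lemma AE_T_pos: "AE \<omega> in M. \<forall>k. 0 < T k \<omega>"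
  unfolding AE_all_countable
proof
  fix k
  have "AE x in exp_law lam. 0 < x"
    unfolding exp_law_def
    by (subst AE_density) (use AE_lborel_singleton[of 0] in
      \<open>auto simp: exponential_density_def elim!: eventually_mono split: if_splits\<close>)
  then show "AE \<omega> in M. 0 < T k \<omega>"
    unfolding T_law[of k, symmetric] by (subst (asm) AE_distr_iff) simp_all
qed

lemma AE_S_nonneg: "AE \<omega> in M. \<forall>m. 0 \<le> S m \<omega>"
  unfolding AE_all_countable
proof
  fix m
  show "AE \<omega> in M. 0 \<le> S m \<omega>"
    using B_nonneg unfolding service[of m, symmetric] by (subst (asm) AE_distr_iff) simp_all
qed

text \<open>
  Conditionally on the service times, each service epoch is a fixed time for the arrival stream,
  and \<open>AE_count_is\<close> applies.
\<close>

lemma AE_streams_regular: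
  "AE \<omega> in M. \<forall>m. \<exists>k. count_is k (\<Sum>i<m. S i \<omega>) (arrival_gaps \<omega>) \<and>
    shd (residual k (\<Sum>i<m. S i \<omega>) (arrival_gaps \<omega>)) \<noteq> 0"
proof -
  (* Restricting to nonnegative epochs makes the property hold for every stream of service times. *)
  let ?R = "\<lambda>p. \<forall>m. 0 \<le> (\<Sum>i<m. fst p !! i) \<longrightarrow> (\<exists>k. count_is k (\<Sum>i<m. fst p !! i) (snd p) \<and>
      shd (residual k (\<Sum>i<m. fst p !! i) (snd p)) \<noteq> 0)"
  have R [measurable]: "Measurable.pred (stream_space B \<Otimes>\<^sub>M stream_space (exp_law lam)) ?R"
    by measurable
  have "AE p in stream_space B \<Otimes>\<^sub>M stream_space (exp_law lam). ?R p"
  proof (rule streams.AE_pair_measure)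
    show "AE \<sigma> in stream_space B. AE \<tau> in stream_space (exp_law lam). ?R (\<sigma>, \<tau>)"
    proof (rule AE_I2, subst AE_all_countable, rule allI)
      fix \<sigma> :: "real stream" and m
      show "AE \<tau> in stream_space (exp_law lam). 0 \<le> (\<Sum>i<m. fst (\<sigma>, \<tau>) !! i) \<longrightarrow>
          (\<exists>k. count_is k (\<Sum>i<m. fst (\<sigma>, \<tau>) !! i) (snd (\<sigma>, \<tau>)) \<and>
            shd (residual k (\<Sum>i<m. fst (\<sigma>, \<tau>) !! i) (snd (\<sigma>, \<tau>))) \<noteq> 0)"
        using AE_count_is[of "\<Sum>i<m. \<sigma> !! i"] by (cases "0 \<le> (\<Sum>i<m. \<sigma> !! i)") simp_all
    qed
  qed (use R in \<open>simp add: pred_def\<close>)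
  then have "AE \<omega> in M. ?R (service_times \<omega>, arrival_gaps \<omega>)"
    unfolding streams_joint_law[symmetric] by (subst (asm) AE_distr_iff) simp_all
  then show ?thesis
    using AE_S_nonneg
    by eventually_elim (simp add: service_times_def to_stream_def sum_nonneg)
qed

text \<open>
  A regular arrival stream provides arrivals beyond every service epoch, and none of them coincides
  with an epoch.
\<close>

lemma AE_sample_path:
  "AE \<omega> in M. sample_path (arrival_time T \<omega>) (\<lambda>m. S m \<omega>) \<and>
    (\<forall>m. arrival_time T \<omega> (arrivals_until (arrival_time T \<omega>) (\<lambda>m. S m \<omega>) m) \<noteq>
      service_epoch (arrival_time T \<omega>) (\<lambda>m. S m \<omega>) m)"
  using AE_T_pos AE_S_nonneg AE_streams_regular
proof eventually_elim
  case (elim \<omega>)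
  let ?a = "arrival_time T \<omega>" and ?s = "\<lambda>m. S m \<omega>"
  have gaps: "arrival_gaps \<omega> = gaps ?a (?a 0) 1"
    unfolding gaps_initial arrival_gaps_def by (simp add: arrival_time_def)
  have mono: "strict_mono ?a"
    using elim(1) by (auto simp: strict_mono_Suc_iff arrival_time_def)
  have reg: "\<exists>k\<ge>1. (\<forall>i. 1 \<le> i \<and> i < k \<longrightarrow> ?a i < service_epoch ?a ?s m) \<and>
      service_epoch ?a ?s m \<le> ?a k \<and> ?a k \<noteq> service_epoch ?a ?s m" for m
  proof -
    obtain k where "count_is k (\<Sum>i<m. ?s i) (gaps ?a (?a 0) 1)"
      "shd (residual k (\<Sum>i<m. ?s i) (gaps ?a (?a 0) 1)) \<noteq> 0"
      using elim(3) gaps by auto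
    then have k: "\<forall>i<k. ?a (1 + i) < service_epoch ?a ?s m" "service_epoch ?a ?s m \<le> ?a (1 + k)"
      "?a (1 + k) \<noteq> service_epoch ?a ?s m"
      by (auto simp: count_is_gaps residual_gaps service_epoch_def)
    have "?a i < service_epoch ?a ?s m" if "1 \<le> i" "i < 1 + k" for i
      using k(1)[rule_format, of "i - 1"] that by simp
    then show ?thesis using k by (intro exI[of _ "1 + k"]) auto
  qed
  interpret sample_path n ?a ?s for n
    by unfold_locales (use mono elim(2) reg in blast)+
  have "?a (c m) \<noteq> D m" for m
  proof -
    obtain k where k: "1 \<le> k" "\<forall>i. 1 \<le> i \<and> i < k \<longrightarrow> ?a i < D m" "D m \<le> ?a k" "?a k \<noteq> D m"
      using reg by blast
    have "c m = k"
      using c_le[OF k(1,3)] k(2) D_le_c[of m] c_ge_1[of m]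
      by (metis antisym_conv2 linorder_not_less)
    then show ?thesis using k(4) by simp
  qed
  then show ?case using sample_path_axioms by blast
qed

lemma arrival_time_measurable: "(\<lambda>\<omega>. arrival_time T \<omega> k) \<in> borel_measurable M"
  unfolding arrival_time_def by measurable

lemma cost_streams:
  "cost n r m i (arrival_gaps \<omega>) (service_times \<omega>) =
    cost n r m i (to_stream (\<lambda>k. arrival_time T \<omega> (Suc k) - arrival_time T \<omega> k)) (to_stream (\<lambda>m. S m \<omega>))"
  by (simp add: arrival_gaps_def service_times_def arrival_time_def)

end

section \<open>The loss probability\<close>

text \<open>
  The setting of the theorem, in which the counts of the sample paths and the solutions of the
  first step equations meet.
\<close>

locale critical_queue = MGI1_input +
  assumes critical': "rho lam B 1 = 1" and square_integrable: "integrable B (\<lambda>x. x ^ 2)"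
begin

sublocale critical_input lam B
  by (rule critical_input.intro[OF poisson_input_axioms],
      rule critical_input_axioms.intro[OF B_integrable critical' square_integrable])

text \<open>
  Finiteness of the mean cost for services shows that the queue almost surely empties, and then the
  pathwise identities apply.
\<close>

lemma AE_SUP_cost:
  assumes n: "1 \<le> n"
  shows "AE \<omega> in M.
    (SUP m. cost n (\<lambda>_ _. 1) m 1 (arrival_gaps \<omega>) (service_times \<omega>)) =
      ennreal (real (num_processed n (arrival_time T \<omega>) (\<lambda>m. S m \<omega>))) \<and>
    (SUP m. cost n (\<lambda>i k. ennreal (real (i - 1 + k - n))) m 1 (arrival_gaps \<omega>) (service_times \<omega>)) =
      ennreal (real (num_refused n (arrival_time T \<omega>) (\<lambda>m. S m \<omega>)))"
proof -
  have "AE \<omega> in M. (SUP m. cost n (\<lambda>_ _. 1) m 1 (arrival_gaps \<omega>) (service_times \<omega>)) \<noteq> \<infinity>"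
  proof (rule nn_integral_PInf_AE)
    show "(\<integral>\<^sup>+\<omega>. (SUP m. cost n (\<lambda>_ _. 1) m 1 (arrival_gaps \<omega>) (service_times \<omega>)) \<partial>M) \<noteq> \<infinity>"
      unfolding nn_integral_SUP_cost SUP_mean_cost_processed[OF n] by simp
  qed measurable
  with AE_sample_path show ?thesis
  proof eventually_elim
    case (elim \<omega>)
    interpret sample_path n "arrival_time T \<omega>" "\<lambda>m. S m \<omega>"
      using elim(1) by blast
    have no_tie: "arrival_time T \<omega> (c m) \<noteq> D m" for m
      using elim(1) by blast
    show ?case
      using SUP_cost_path[OF queue_empties no_tie] elim(2) unfolding cost_streams by simp
  qed
qed

lemma EP_eq:
  assumes n: "1 \<le> n"
  shows "EP M T S n = mean_busy n"
proof -
  have "(\<integral>\<^sup>+\<omega>. ennreal (real (num_processed n (arrival_time T \<omega>) (\<lambda>m. S m \<omega>))) \<partial>M) =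
      (\<integral>\<^sup>+\<omega>. (SUP m. cost n (\<lambda>_ _. 1) m 1 (arrival_gaps \<omega>) (service_times \<omega>)) \<partial>M)"
    by (rule nn_integral_cong_AE, rule eventually_mono[OF AE_SUP_cost[OF n]]) (elim conjE, simp only:)
  also have "\<dots> = ennreal (mean_busy n)"
    by (simp only: nn_integral_SUP_cost SUP_mean_cost_processed[OF n])
  finally have "(\<integral>\<^sup>+\<omega>. ennreal (real (num_processed n (arrival_time T \<omega>) (\<lambda>m. S m \<omega>))) \<partial>M) = ennreal (mean_busy n)" .
  moreover have [measurable]: "(\<lambda>\<omega>. num_processed n (arrival_time T \<omega>) (\<lambda>m. S m \<omega>)) \<in> measurable M (count_space UNIV)"
    by (rule num_processed_measurable) (simp_all add: arrival_time_measurable)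
  ultimately show ?thesis
    unfolding EP_def
    by (subst integral_eq_nn_integral) (simp_all add: mean_busy_nonneg)
qed

lemma ER_eq:
  assumes n: "1 \<le> n"
  shows "ER M T S n = 1"
proof -
  have "(\<integral>\<^sup>+\<omega>. ennreal (real (num_refused n (arrival_time T \<omega>) (\<lambda>m. S m \<omega>))) \<partial>M) =
      (\<integral>\<^sup>+\<omega>. (SUP m. cost n (\<lambda>i k. ennreal (real (i - 1 + k - n))) m 1
        (arrival_gaps \<omega>) (service_times \<omega>)) \<partial>M)"
    by (rule nn_integral_cong_AE, rule eventually_mono[OF AE_SUP_cost[OF n]]) (elim conjE, simp only:)
  also have "\<dots> = 1"
    by (simp only: nn_integral_SUP_cost SUP_mean_cost_refused[OF n])
  finally have "(\<integral>\<^sup>+\<omega>. ennreal (real (num_refused n (arrival_time T \<omega>) (\<lambda>m. S m \<omega>))) \<partial>M) = 1" .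
  moreover have [measurable]: "(\<lambda>\<omega>. num_refused n (arrival_time T \<omega>) (\<lambda>m. S m \<omega>)) \<in> measurable M (count_space UNIV)"
    by (rule num_refused_measurable) (simp_all add: arrival_time_measurable)
  ultimately show ?thesis
    unfolding ER_def
    by (subst integral_eq_nn_integral) simp_all
qed

lemma loss_prob_diff:
  assumes "1 \<le> n"
  shows "loss_prob M T S p (n + 1) - loss_prob M T S p n =
    (p - 1) * increment n / ((1 + mean_busy n) * (1 + mean_busy (n + 1)))"
proof -
  have "1 + mean_busy m \<noteq> 0" for m
    using mean_busy_nonneg[of m] by linarith
  moreover have "increment n = mean_busy (n + 1) - mean_busy n"
    by (simp add: mean_busy_def)
  ultimately show ?thesis
    using assms by (simp add: loss_prob_def EP_eq ER_eq divide_simps) (simp add: algebra_simps)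
qed

lemma rho_2_pos: "0 < rho lam B 2"
proof -
  have "0 < suminf excess"
    using excess_sums excess_nonneg excess_0 pmf_arrivals_0_pos
    by (intro suminf_pos2[of excess 0]) (auto dest: sums_summable)
  then show ?thesis
    using excess_sums by (simp add: sums_iff)
qed

lemma loss_prob_diff_tendsto:
  "(\<lambda>n. real n ^ 2 * (loss_prob M T S p (n + 1) - loss_prob M T S p n))
    \<longlonglongrightarrow> (p - 1) / (2 / rho lam B 2)"
proof -
  define r where "r = 2 / rho lam B 2"
  have r: "0 < r"
    using rho_2_pos by (simp add: r_def)
  have incr: "increment \<longlonglongrightarrow> r"
    unfolding r_def by (rule increment_tendsto)
  have inv: "(\<lambda>n. 1 / real n) \<longlonglongrightarrow> 0"
    by (rule lim_const_over_n)
  have "(\<lambda>n. increment n * (1 / real n)) \<longlonglongrightarrow> r * 0"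
    by (intro tendsto_mult incr inv)
  then have "(\<lambda>n. mean_busy n / real n) \<longlonglongrightarrow> r" "(\<lambda>n. increment n * (1 / real n)) \<longlonglongrightarrow> 0"
    unfolding mean_busy_def by (simp_all add: cesaro_tendsto incr)
  then have "(\<lambda>n. (p - 1) * increment n / ((1 / real n + mean_busy n / real n) *
      (1 / real n + mean_busy n / real n + increment n * (1 / real n))))
      \<longlonglongrightarrow> (p - 1) * r / ((0 + r) * (0 + r + 0))"
    using r by (intro tendsto_intros incr inv) simp_all
  moreover have "\<forall>\<^sub>F n in sequentially. (p - 1) * increment n / ((1 / real n + mean_busy n / real n) *
      (1 / real n + mean_busy n / real n + increment n * (1 / real n))) =
      real n ^ 2 * (loss_prob M T S p (n + 1) - loss_prob M T S p n)"
    using eventually_ge_at_top[of 1]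
  proof eventually_elim
    case (elim n)
    have "1 / real n + mean_busy n / real n = (1 + mean_busy n) / real n"
      by (simp add: add_divide_distrib)
    moreover have "1 / real n + mean_busy n / real n + increment n * (1 / real n) =
        (1 + mean_busy (n + 1)) / real n"
      by (simp add: mean_busy_def add_divide_distrib)
    ultimately show ?case
      using elim by (simp only: loss_prob_diff) (simp add: power2_eq_square)
  qed
  ultimately have "(\<lambda>n. real n ^ 2 * (loss_prob M T S p (n + 1) - loss_prob M T S p n))
      \<longlonglongrightarrow> (p - 1) * r / ((0 + r) * (0 + r + 0))"
    by (rule Lim_transform_eventually)
  then show ?thesis
    using r by (simp add: r_def[symmetric])
qed

end

theorem theorem5p5:
  fixes M :: "'w measure" and lam p :: real and B :: "real measure"
    and T S :: "nat \<Rightarrow> 'w \<Rightarrow> real"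
  assumes "MGI1_input M lam B T S"
    and "0 \<le> p" and "p \<le> 1"
    and "rho lam B 1 = 1"
    and "integrable B (\<lambda>x. x ^ 2)"
  shows "(\<lambda>n. (loss_prob M T S p (n + 1) - loss_prob M T S p n)
            - (1 / (real n * (real n + 1)) * (2 / rho lam B 2) * (p - 1))
              / ((2 / rho lam B 2 + 1 / (real n + 1)) * (2 / rho lam B 2 + 1 / real n)))
         \<in> o(\<lambda>n. 1 / (real n) ^ 2)"
proof -
  interpret MGI1_input M lam B T S by fact
  interpret critical_queue M lam B T S
    by unfold_locales fact+
  define r where "r = 2 / rho lam B 2"
  have r: "0 < r"
    using rho_2_pos by (simp add: r_def)
  let ?main = "\<lambda>n. (1 / (real n * (real n + 1)) * r * (p - 1)) / ((r + 1 / (real n + 1)) * (r + 1 / real n))"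
  let ?diff = "\<lambda>n. loss_prob M T S p (n + 1) - loss_prob M T S p n"
  have "(\<lambda>n. real n ^ 2 * ?main n) \<longlonglongrightarrow> r * (p - 1) * (inverse r * inverse r)"
    using r by real_asymp
  also have "r * (p - 1) * (inverse r * inverse r) = (p - 1) / r"
    using r by (simp add: field_simps)
  finally have "(\<lambda>n. real n ^ 2 * ?main n) \<longlonglongrightarrow> (p - 1) / r" .
  moreover have "(\<lambda>n. real n ^ 2 * ?diff n) \<longlonglongrightarrow> (p - 1) / r"
    unfolding r_def by (rule loss_prob_diff_tendsto)
  ultimately have "(\<lambda>n. real n ^ 2 * ?diff n - real n ^ 2 * ?main n) \<longlonglongrightarrow> (p - 1) / r - (p - 1) / r"
    by (rule tendsto_diff[rotated])
  then have "(\<lambda>n. (?diff n - ?main n) / (1 / real n ^ 2)) \<longlonglongrightarrow> 0"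
    by (simp add: algebra_simps)
  moreover have "\<forall>\<^sub>F n in sequentially. 1 / real n ^ 2 \<noteq> 0"
    using eventually_gt_at_top[of 0] by eventually_elim simp
  ultimately show ?thesis
    unfolding r_def by (intro smalloI_tendsto)
qed

end
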